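(* Let $\Omega\subset\mathbb{R}^n$ be a bounded domain. Let $f:\mathbb{R}^{n+1}\to\mathbb{R}$ be a $C^1$ function whose gradient is non-constant and Lipschitzian, and let $L$ be the Lipschitz constant of $\nabla f$. Let $g:\mathbb{R}^{n+1}\to\mathbb{R}$ be a non-negative $C^1$ function with $g(0)=0$ whose gradient is Lipschitzian with Lipschitz constant $\nu<2$. For $u\in H^1(\Omega)$ put $$J(u)=\int_\Omega f(u(x),\nabla u(x))\,dx,\qquad I(u)=\int_\Omega g(u(x),\nabla u(x))\,dx .$$ Let $V$ be a closed linear subspace of $H^1(\Omega)$ for which there exists $v_0\in V$ such that $$\int_\Omega\bigl(f_\xi(0)v_0(x)+\nabla_\eta f(0)\cdot\nabla v_0(x)\bigr)\,dx\neq 0 .$$ Let $S$ be the (possibly empty) set of all global minima of the restriction to $V$ of the functional $$u\mapsto \|u\|^2+I(u)+\frac{2-\nu}{L}J(u).$$ Then $$\delta:=\inf_{u\in S}\bigl(\|u\|^2+I(u)\bigr)>0$$ (with the convention $\inf\emptyset=+\infty$), and, for each $r\in\,]0,\delta[$, the restriction of the functional $J$ to the set $$C_r:=\{u\in V:\ \|u\|^2+I(u)=r\}$$ has a unique global minimum (that is, there is exactly one point of $C_r$ at which $J_{|C_r}$ attains its infimum).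
   Context: Functions are real-valued. The Sobolev space $H^1(\Omega)$ is endowed with the norm $\|u\|=\left(\int_\Omega(|\nabla u(x)|^2+|u(x)|^2)\,dx\right)^{1/2}$, induced by the scalar product $\langle u,v\rangle=\int_\Omega(\nabla u(x)\cdot\nabla v(x)+u(x)v(x))\,dx$. Points of $\mathbb{R}^{n+1}=\mathbb{R}\times\mathbb{R}^n$ are written $(\xi,\eta)$ with $\xi\in\mathbb{R}$, $\eta\in\mathbb{R}^n$; $f_\xi$ denotes the partial derivative of $f$ with respect to $\xi$ and $\nabla_\eta f$ the gradient of $f$ with respect to $\eta$. "Lipschitzian" is with respect to the Euclidean metric. Because $\nabla f$ and $\nabla g$ have linear growth, $J$ and $I$ are well defined and $C^1$ on $H^1(\Omega)$. Since $\nabla f$ is non-constant, $L>0$. A global minimum of a functional on a set means a point of that set at which the functional attains its infimum over the set. *)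

theory Defs
  imports "HOL-Analysis.Analysis"
begin

primrec C_k :: "nat \<Rightarrow> ('a::euclidean_space \<Rightarrow> real) \<Rightarrow> bool" where
  "C_k 0 \<phi> \<longleftrightarrow> continuous_on UNIV \<phi>"
| "C_k (Suc k) \<phi> \<longleftrightarrow>
     (\<forall>x. \<phi> differentiable (at x)) \<and>
     (\<forall>i\<in>Basis. C_k k (\<lambda>x. frechet_derivative \<phi> (at x) i))"

(* The space of smooth functions with compact support in \<Omega>, extended by zero to the whole space. *)
definition test_functions :: "'a::euclidean_space set \<Rightarrow> ('a \<Rightarrow> real) set" where
  "test_functions \<Omega> =
     {\<phi>. (\<forall>k. C_k k \<phi>) \<and> compact (closure {x. \<phi> x \<noteq> 0}) \<and> closure {x. \<phi> x \<noteq> 0} \<subseteq> \<Omega>}"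

(* Elements of L^2 and H^1 are represented by functions on the whole space whose values outside
   \<Omega> are irrelevant; functions that agree almost everywhere on \<Omega> represent the same element. *)
definition L2 :: "'a::euclidean_space set \<Rightarrow> ('a \<Rightarrow> 'b::euclidean_space) set" where
  "L2 \<Omega> = {u \<in> borel_measurable (lebesgue_on \<Omega>). integrable (lebesgue_on \<Omega>) (\<lambda>x. (norm (u x))\<^sup>2)}"

definition has_weak_gradient ::
  "'a::euclidean_space set \<Rightarrow> ('a \<Rightarrow> real) \<Rightarrow> ('a \<Rightarrow> 'a) \<Rightarrow> bool" where
  "has_weak_gradient \<Omega> u G \<longleftrightarrow>
     (\<forall>\<phi>\<in>test_functions \<Omega>. \<forall>i\<in>Basis.
        (LINT x|lebesgue_on \<Omega>. u x * frechet_derivative \<phi> (at x) i) =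
        - (LINT x|lebesgue_on \<Omega>. (G x \<bullet> i) * \<phi> x))"

definition H1 :: "'a::euclidean_space set \<Rightarrow> ('a \<Rightarrow> real) set" where
  "H1 \<Omega> = {u \<in> L2 \<Omega>. \<exists>G\<in>L2 \<Omega>. has_weak_gradient \<Omega> u G}"

(* A representative of the weak gradient, which is determined up to a null set if \<Omega> is open. *)
definition wgrad :: "'a::euclidean_space set \<Rightarrow> ('a \<Rightarrow> real) \<Rightarrow> 'a \<Rightarrow> 'a" where
  "wgrad \<Omega> u = (SOME G. G \<in> L2 \<Omega> \<and> has_weak_gradient \<Omega> u G)"

definition H1_norm :: "'a::euclidean_space set \<Rightarrow> ('a \<Rightarrow> real) \<Rightarrow> real" where
  "H1_norm \<Omega> u = sqrt (LINT x|lebesgue_on \<Omega>. (norm (wgrad \<Omega> u x))\<^sup>2 + (u x)\<^sup>2)"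

(* The last clause, applied to constant sequences, makes V closed under equality almost everywhere
   on \<Omega>, so that V corresponds to a closed subspace of the space of equivalence classes. *)
definition closed_subspace_H1 :: "'a::euclidean_space set \<Rightarrow> ('a \<Rightarrow> real) set \<Rightarrow> bool" where
  "closed_subspace_H1 \<Omega> V \<longleftrightarrow>
     V \<subseteq> H1 \<Omega> \<and>
     (\<lambda>x. 0) \<in> V \<and>
     (\<forall>u\<in>V. \<forall>v\<in>V. (\<lambda>x. u x + v x) \<in> V) \<and>
     (\<forall>c. \<forall>u\<in>V. (\<lambda>x. c * u x) \<in> V) \<and>
     (\<forall>s. \<forall>u\<in>H1 \<Omega>.
        (\<forall>k::nat. s k \<in> V) \<and> (\<lambda>k. H1_norm \<Omega> (\<lambda>x. s k x - u x)) \<longlonglongrightarrow> 0 \<longrightarrow> u \<in> V)"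

definition integral_functional ::
  "'a::euclidean_space set \<Rightarrow> (real \<times> 'a \<Rightarrow> real) \<Rightarrow> ('a \<Rightarrow> real) \<Rightarrow> real" where
  "integral_functional \<Omega> h u = (LINT x|lebesgue_on \<Omega>. h (u x, wgrad \<Omega> u x))"

definition global_minima :: "('b \<Rightarrow> real) \<Rightarrow> 'b set \<Rightarrow> 'b set" where
  "global_minima F A = {u \<in> A. \<forall>v\<in>A. F u \<le> F v}"

definition is_gradient :: "('b::euclidean_space \<Rightarrow> real) \<Rightarrow> ('b \<Rightarrow> 'b) \<Rightarrow> bool" where
  "is_gradient h Dh \<longleftrightarrow> (\<forall>p. GDERIV h p :> Dh p)"

definition least_lipschitz_constant ::
  "('b::metric_space \<Rightarrow> 'c::metric_space) \<Rightarrow> real \<Rightarrow> bool" where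
  "least_lipschitz_constant F L \<longleftrightarrow>
     L-lipschitz_on UNIV F \<and> (\<forall>C. C-lipschitz_on UNIV F \<longrightarrow> L \<le> C)"

end

theory Submission
  imports Defs "HOL-Computational_Algebra.Polynomial"
begin

text \<open>
  Write \<open>P\<^sub>u = (u, \<nabla>u)\<close>. Both \<open>\<Phi>(u) = \<parallel>u\<parallel>\<^sup>2 + I(u)\<close> and \<open>J\<close> are integrals of a function of \<open>P\<^sub>u\<close>, so a
  pointwise inequality between the integrands becomes one between the functionals. A function whose
  gradient is \<open>l\<close>-Lipschitzian differs from its mean over two points \<open>p, q\<close>, at their midpoint, by at
  most \<open>l/8 |p - q|\<^sup>2\<close>, whereas for \<open>|p|\<^sup>2\<close> this gap is exactly \<open>1/4 |p - q|\<^sup>2\<close>. Hence \<open>\<Phi>\<close> is strongly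
  midpoint convex with constant \<open>(2 - \<nu>)/8\<close>, and \<open>H = \<Phi> + (2 - \<nu>)/L J\<close>, whose minimizers
  form \<open>S\<close>, is still midpoint convex: the multiple \<open>(2 - \<nu>)/L\<close> of \<open>J\<close> uses up exactly the strong
  convexity of \<open>\<Phi>\<close>.

  For \<open>0 \<le> t < 1\<close> the combination \<open>(1 - t) \<Phi> + t H = \<Phi> + t (2 - \<nu>)/L J\<close> is strongly convex and
  bounded below, so it has a minimizer \<open>u\<^sub>t\<close>, unique up to null sets, and for \<open>t > 0\<close> this \<open>u\<^sub>t\<close> is the
  only minimum of \<open>J\<close> on its own level set of \<open>\<Phi>\<close>. It remains to see that every level \<open>r\<close> in \<open>]0, \<delta>[\<close>
  occurs. The values \<open>\<Phi>(u\<^sub>t)\<close> increase with \<open>t\<close> from \<open>0\<close>, and the squared distance of two minimizers is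
  at most a constant times the difference of their \<open>\<Phi>\<close>-values. As long as these values stay bounded,
  minimizers along a convergent sequence of parameters therefore have a strongly convergent
  subsequence, and its limit minimizes the limit functional. At the supremum of
  the parameters with \<open>\<Phi>(u\<^sub>t) \<le> r\<close> this gives \<open>\<Phi>(u\<^sub>t) = r\<close>, unless the supremum is \<open>1\<close>; but then the limit is a point of \<open>S\<close> with \<open>\<Phi> \<le> r < \<delta>\<close>, which is absurd
  (\<open>convex_pair.minimizer_on_level\<close>).

  That \<open>\<delta> > 0\<close> holds because a sequence in \<open>S\<close> with \<open>\<Phi> \<rightarrow> 0\<close> would converge to \<open>0\<close>, making \<open>0\<close> a
  minimizer of \<open>H\<close>; but the derivative of \<open>H\<close> at \<open>0\<close> in the direction \<open>v\<^sub>0\<close> is a nonzero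
  multiple of the integral assumed not to vanish, since \<open>\<nabla>g(0) = 0\<close>.

  Two classical facts are needed to work in \<open>V\<close>: it is complete, which rests on the completeness of
  \<open>L\<^sup>2\<close> (\<open>square_integrable_complete\<close>), and weak gradients are unique, so that the chosen
  representative \<open>wgrad\<close> is linear and stable under limits (\<open>has_weak_gradient_unique\<close>).
\<close>

section \<open>Functions with Lipschitz gradient\<close>

lemma is_gradient_imp_continuous_on:
  assumes "is_gradient h Dh"
  shows "continuous_on UNIV h"
proof (rule continuous_at_imp_continuous_on, rule ballI)
  fix x
  have "(h has_derivative (\<lambda>v. v \<bullet> Dh x)) (at x)"
    using assms by (simp add: is_gradient_def gderiv_def)
  then show "isCont h x"
    by (rule has_derivative_continuous)
qed

lemma gradient_eq_0_at_minimum: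
  fixes h :: "'b::euclidean_space \<Rightarrow> real"
  assumes "is_gradient h Dh" "\<And>q. h p \<le> h q"
  shows "Dh p = 0"
proof -
  have "(h has_derivative (\<lambda>v. v \<bullet> Dh p)) (at p)"
    using assms(1) by (simp add: is_gradient_def gderiv_def)
  then have "(\<lambda>v. v \<bullet> Dh p) = (\<lambda>v. 0)"
    by (rule differential_zero_maxmin[OF UNIV_I open_UNIV]) (use assms(2) in simp)
  then have "Dh p \<bullet> Dh p = 0"
    by metis
  then show ?thesis by simp
qed

text \<open>Along the segment from \<open>p\<close> to \<open>q\<close>, the Lipschitz bound makes the derivative of the error of the
  first-order expansion grow at most linearly. The constant \<open>l / 2\<close> is sharp, and sharpness matters: it
  is what makes the multiple \<open>(2 - \<nu>)/L\<close> of \<open>J\<close> admissible.\<close>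

lemma gradient_lipschitz_upper_bound:
  fixes h :: "'b::euclidean_space \<Rightarrow> real"
  assumes grad: "is_gradient h Dh" and lip: "l-lipschitz_on UNIV Dh"
  shows "h q - h p - Dh p \<bullet> (q - p) \<le> l / 2 * (norm (q - p))\<^sup>2"
proof -
  define d where "d = q - p"
  define \<phi> where "\<phi> = (\<lambda>t. h (p + t *\<^sub>R d) - t * (Dh p \<bullet> d) - l / 2 * t\<^sup>2 * (norm d)\<^sup>2)"
  have "(\<phi> has_real_derivative (Dh (p + t *\<^sub>R d) - Dh p) \<bullet> d - l * t * (norm d)\<^sup>2) (at t)" for t
  proof -
    have "((\<lambda>t. p + t *\<^sub>R d) has_derivative (\<lambda>s. s *\<^sub>R d)) (at t)"
      by (auto intro!: derivative_eq_intros)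
    moreover have "(h has_derivative (\<lambda>v. v \<bullet> Dh (p + t *\<^sub>R d))) (at (p + t *\<^sub>R d))"
      using grad by (simp add: is_gradient_def gderiv_def)
    ultimately have "((\<lambda>t. h (p + t *\<^sub>R d)) has_derivative (\<lambda>s. s *\<^sub>R d \<bullet> Dh (p + t *\<^sub>R d))) (at t)"
      using has_derivative_compose by blast
    then have "((\<lambda>t. h (p + t *\<^sub>R d)) has_real_derivative d \<bullet> Dh (p + t *\<^sub>R d)) (at t)"
      by (rule has_derivative_imp_has_field_derivative) (simp add: mult.commute)
    then show ?thesis
      unfolding \<phi>_def
      by (auto intro!: derivative_eq_intros simp: inner_diff_left inner_diff_right inner_commute algebra_simps)
  qed
  moreover have "(Dh (p + t *\<^sub>R d) - Dh p) \<bullet> d - l * t * (norm d)\<^sup>2 \<le> 0" if "0 \<le> t" for t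
  proof -
    have "(Dh (p + t *\<^sub>R d) - Dh p) \<bullet> d \<le> norm (Dh (p + t *\<^sub>R d) - Dh p) * norm d"
      by (rule norm_cauchy_schwarz)
    also have "\<dots> \<le> (l * norm (t *\<^sub>R d)) * norm d"
      using lipschitz_onD[OF lip, of "p + t *\<^sub>R d" p] by (intro mult_right_mono) (auto simp: dist_norm)
    finally show ?thesis
      using that by (simp add: power2_eq_square mult_ac)
  qed
  ultimately have "\<phi> 1 \<le> \<phi> 0"
    by (intro DERIV_nonpos_imp_nonincreasing[of 0 1]) (auto simp only:)
  then show ?thesis
    by (simp add: \<phi>_def d_def)
qed

lemma gradient_lipschitz_bound:
  fixes h :: "'b::euclidean_space \<Rightarrow> real"
  assumes grad: "is_gradient h Dh" and lip: "l-lipschitz_on UNIV Dh"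
  shows "\<bar>h q - h p - Dh p \<bullet> (q - p)\<bar> \<le> l / 2 * (norm (q - p))\<^sup>2"
proof -
  have "is_gradient (\<lambda>p. - h p) (\<lambda>p. - Dh p)"
    using grad by (auto simp: is_gradient_def intro: GDERIV_minus)
  moreover have "l-lipschitz_on UNIV (\<lambda>p. - Dh p)"
    using lip by (simp add: lipschitz_on_def dist_minus)
  ultimately have "- h q - - h p - - Dh p \<bullet> (q - p) \<le> l / 2 * (norm (q - p))\<^sup>2"
    by (rule gradient_lipschitz_upper_bound)
  with gradient_lipschitz_upper_bound[OF assms, of q p] show ?thesis
    unfolding abs_le_iff inner_minus_left by linarith
qed

text \<open>Expanding at the midpoint, the two first-order terms cancel.\<close>

lemma gradient_lipschitz_midpoint:
  fixes h :: "'b::euclidean_space \<Rightarrow> real"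
  assumes grad: "is_gradient h Dh" and lip: "l-lipschitz_on UNIV Dh"
  shows "\<bar>h p + h q - 2 * h ((1 / 2) *\<^sub>R (p + q))\<bar> \<le> l / 4 * (norm (p - q))\<^sup>2"
proof -
  let ?m = "(1 / 2) *\<^sub>R (p + q)"
  have d: "p - ?m = (1 / 2) *\<^sub>R (p - q)" "q - ?m = - ((1 / 2) *\<^sub>R (p - q))"
    by (auto simp: algebra_simps simp flip: scaleR_add_left)
  have "\<bar>h p - h ?m - Dh ?m \<bullet> ((1 / 2) *\<^sub>R (p - q))\<bar> \<le> l / 8 * (norm (p - q))\<^sup>2"
    using gradient_lipschitz_bound[OF assms, of p ?m] unfolding d by (simp add: power_divide)
  moreover have "\<bar>h q - h ?m + Dh ?m \<bullet> ((1 / 2) *\<^sub>R (p - q))\<bar> \<le> l / 8 * (norm (p - q))\<^sup>2"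
    using gradient_lipschitz_bound[OF assms, of q ?m] unfolding d
    by (simp add: power_divide inner_minus_right)
  ultimately show ?thesis unfolding abs_le_iff by linarith
qed

lemma is_gradient_norm_power2: "is_gradient (\<lambda>p::'b::euclidean_space. (norm p)\<^sup>2) (\<lambda>p. 2 *\<^sub>R p)"
  unfolding is_gradient_def gderiv_def power2_norm_eq_inner
  by (auto intro!: derivative_eq_intros simp: inner_commute)

lemma lipschitz_norm_power2_gradient: "2-lipschitz_on UNIV (\<lambda>p::'b::euclidean_space. 2 *\<^sub>R p)"
  by (rule lipschitz_onI) (auto simp: dist_norm simp flip: scaleR_diff_right)

section \<open>Square integrable functions\<close>

text \<open>On \<open>lebesgue_on \<Omega>\<close> this is membership in \<open>L2 \<Omega>\<close>.\<close>

definition square_integrable :: "'x measure \<Rightarrow> ('x \<Rightarrow> 'b::euclidean_space) \<Rightarrow> bool" where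
  "square_integrable M P \<longleftrightarrow> P \<in> borel_measurable M \<and> integrable M (\<lambda>x. (norm (P x))\<^sup>2)"

text \<open>The square of the \<open>L\<^sup>2\<close> distance. All estimates below are quadratic, and the square satisfies
  \<open>sqdist M P R \<le> 2 sqdist M P Q + 2 sqdist M Q R\<close>, which serves as a triangle inequality.\<close>

definition sqdist :: "'x measure \<Rightarrow> ('x \<Rightarrow> 'b::euclidean_space) \<Rightarrow> ('x \<Rightarrow> 'b) \<Rightarrow> real" where
  "sqdist M P Q = (LINT x|M. (norm (P x - Q x))\<^sup>2)"

lemma square_integrable_measurable [measurable_dest]:
  "square_integrable M P \<Longrightarrow> P \<in> borel_measurable M"
  by (simp add: square_integrable_def)

lemma power2_norm_add_le: "(norm (x + y))\<^sup>2 \<le> 2 * (norm x)\<^sup>2 + 2 * (norm (y::'b::real_normed_vector))\<^sup>2"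
proof -
  have "(norm (x + y))\<^sup>2 \<le> (norm x + norm y)\<^sup>2"
    by (intro power_mono norm_triangle_ineq) simp
  also have "\<dots> \<le> 2 * (norm x)\<^sup>2 + 2 * (norm y)\<^sup>2"
    using sum_squares_bound[of "norm x" "norm y"] by (simp add: power2_sum)
  finally show ?thesis .
qed

lemma square_integrable_add:
  assumes "square_integrable M P" "square_integrable M Q"
  shows "square_integrable M (\<lambda>x. P x + Q x)"
proof -
  have "integrable M (\<lambda>x. 2 * (norm (P x))\<^sup>2 + 2 * (norm (Q x))\<^sup>2)"
    using assms by (auto simp: square_integrable_def)
  then have "integrable M (\<lambda>x. (norm (P x + Q x))\<^sup>2)"
    by (rule Bochner_Integration.integrable_bound)
       (use assms power2_norm_add_le in \<open>auto simp: square_integrable_def\<close>)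
  then show ?thesis
    using assms by (simp add: square_integrable_def borel_measurable_add)
qed

lemma square_integrable_scaleR:
  "square_integrable M P \<Longrightarrow> square_integrable M (\<lambda>x. c *\<^sub>R P x)"
  by (simp add: square_integrable_def power_mult_distrib borel_measurable_scaleR)

lemma square_integrable_diff:
  "square_integrable M P \<Longrightarrow> square_integrable M Q \<Longrightarrow> square_integrable M (\<lambda>x. P x - Q x)"
  using square_integrable_add[of M P "\<lambda>x. - 1 *\<^sub>R Q x"] square_integrable_scaleR[of M Q "- 1"] by simp

lemma sqdist_integrable:
  "square_integrable M P \<Longrightarrow> square_integrable M Q \<Longrightarrow> integrable M (\<lambda>x. (norm (P x - Q x))\<^sup>2)"
  using square_integrable_diff[of M P Q] by (simp add: square_integrable_def)

lemma sqdist_nonneg: "0 \<le> sqdist M P Q"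
  by (simp add: sqdist_def)

lemma sqdist_commute: "sqdist M P Q = sqdist M Q P"
  by (simp add: sqdist_def norm_minus_commute)

lemma sqdist_triangle:
  assumes "square_integrable M P" "square_integrable M Q" "square_integrable M R"
  shows "sqdist M P R \<le> 2 * sqdist M P Q + 2 * sqdist M Q R"
proof -
  note int = sqdist_integrable[OF assms(1,2)] sqdist_integrable[OF assms(2,3)]
    sqdist_integrable[OF assms(1,3)]
  have "sqdist M P R \<le> (LINT x|M. 2 * (norm (P x - Q x))\<^sup>2 + 2 * (norm (Q x - R x))\<^sup>2)"
    unfolding sqdist_def
  proof (intro integral_mono)
    show "(norm (P x - R x))\<^sup>2 \<le> 2 * (norm (P x - Q x))\<^sup>2 + 2 * (norm (Q x - R x))\<^sup>2" for x
      using power2_norm_add_le[of "P x - Q x" "Q x - R x"] by simp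
  qed (intro Bochner_Integration.integrable_add integrable_mult_right int)+
  also have "\<dots> = 2 * sqdist M P Q + 2 * sqdist M Q R"
    by (simp add: sqdist_def Bochner_Integration.integral_add int)
  finally show ?thesis .
qed

lemma geometric_steps_limit:
  fixes p :: "nat \<Rightarrow> 'b::banach"
  assumes step: "\<And>k. norm (p (Suc k) - p k) \<le> s * (1 / 2) ^ k"
  shows "convergent p" "norm (p k - lim p) \<le> 2 * s * (1 / 2) ^ k"
proof -
  have "summable (\<lambda>k. s * (1 / 2 :: real) ^ k)"
    by (intro summable_mult summable_geometric) simp
  then have "summable (\<lambda>k. p (Suc k) - p k)"
    by (rule summable_comparison_test') (use step in auto)
  then have "convergent (\<lambda>n. \<Sum>k<n. p (Suc k) - p k)"
    by (simp add: summable_iff_convergent)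
  then have "convergent (\<lambda>n. p n - p 0)"
    by (simp add: sum_lessThan_telescope)
  then show conv: "convergent p"
    by (simp add: convergent_diff_const_right_iff)
  have far: "norm (p k - p (k + i)) \<le> 2 * s * (1 / 2) ^ k - 2 * s * (1 / 2) ^ (k + i)" for i
  proof (induction i)
    case (Suc i)
    have "norm (p k - p (k + Suc i)) \<le> norm (p k - p (k + i)) + norm (p (Suc (k + i)) - p (k + i))"
      using norm_triangle_ineq4[of "p k - p (k + i)" "p (Suc (k + i)) - p (k + i)"] by simp
    then show ?case
      using Suc step[of "k + i"] by simp
  qed simp
  have s: "s \<ge> 0"
    using order_trans[OF norm_ge_zero step[of 0]] by simp
  have "(\<lambda>i. norm (p k - p (i + k))) \<longlonglongrightarrow> norm (p k - lim p)"
    using conv by (intro tendsto_intros LIMSEQ_ignore_initial_segment) (simp add: convergent_LIMSEQ_iff)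
  then show "norm (p k - lim p) \<le> 2 * s * (1 / 2) ^ k"
  proof (rule LIMSEQ_le_const2, intro exI allI impI)
    fix i :: nat
    have "0 \<le> 2 * s * (1 / 2) ^ (k + i)"
      using s by simp
    then show "norm (p k - p (i + k)) \<le> 2 * s * (1 / 2) ^ k"
      using far[of i] by (simp add: add.commute)
  qed
qed

text \<open>The weighted sum \<open>W = \<Sum>\<^sub>k 4\<^sup>k |P\<^sub>k\<^sub>+\<^sub>1 - P\<^sub>k|\<^sup>2\<close> has finite integral, so it is finite almost
  everywhere. It bounds the step \<open>|P\<^sub>k\<^sub>+\<^sub>1 - P\<^sub>k|\<close> by \<open>2\<^sup>-\<^sup>k sqrt W\<close>, hence the distance to the pointwise limit
  by \<open>2 \<cdot> 2\<^sup>-\<^sup>k sqrt W\<close>, and the square of this bound is integrable.\<close>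

lemma square_integrable_limit_of_fast_Cauchy:
  fixes P :: "nat \<Rightarrow> 'x \<Rightarrow> 'b::euclidean_space"
  assumes P: "\<And>k. square_integrable M (P k)"
    and fast: "\<And>k. sqdist M (P (Suc k)) (P k) \<le> (1 / 8) ^ k"
  obtains Q where "square_integrable M Q" "(\<lambda>k. sqdist M (P k) Q) \<longlonglongrightarrow> 0"
proof -
  define f where "f = (\<lambda>k x. 4 ^ k * (norm (P (Suc k) x - P k x))\<^sup>2)"
  have f_int: "integrable M (f k)" for k
    unfolding f_def using sqdist_integrable[OF P P] by auto
  have f_nonneg: "0 \<le> f k x" for k x
    by (simp add: f_def)
  have f_le: "(LINT x|M. f k x) \<le> (1 / 2) ^ k" for k
  proof -
    have "(LINT x|M. f k x) = 4 ^ k * sqdist M (P (Suc k)) (P k)"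
      by (simp add: f_def sqdist_def)
    also have "\<dots> \<le> 4 ^ k * (1 / 8) ^ k"
      by (intro mult_left_mono fast) simp
    also have "\<dots> = (1 / 2) ^ k"
      by (simp flip: power_mult_distrib)
    finally show ?thesis .
  qed
  have half: "summable (\<lambda>k. (1 / 2 :: real) ^ k)"
    by (intro summable_geometric) simp
  have summ_int: "summable (\<lambda>k. LINT x|M. f k x)"
    by (rule summable_comparison_test'[OF half]) (use f_le f_nonneg in \<open>auto simp: integral_nonneg\<close>)
  have "(\<integral>\<^sup>+x. (\<Sum>k. ennreal (f k x)) \<partial>M) = (\<Sum>k. ennreal (LINT x|M. f k x))"
    using f_int f_nonneg by (subst nn_integral_suminf) (auto simp: nn_integral_eq_integral)
  also have "\<dots> \<noteq> \<infinity>"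
    using summ_int f_nonneg by (simp add: ennreal_suminf_neq_top integral_nonneg)
  finally have "AE x in M. (\<Sum>k. ennreal (f k x)) \<noteq> \<infinity>"
    using f_int by (intro nn_integral_PInf_AE) auto
  then have summ: "AE x in M. summable (\<lambda>k. f k x)"
    by eventually_elim (use f_nonneg in \<open>auto intro: summable_suminf_not_top\<close>)
  define W where "W = (\<lambda>x. \<Sum>k. f k x)"
  have W_int: "integrable M W"
    unfolding W_def using summ f_nonneg summ_int f_int by (intro integrable_suminf) auto
  define Q where "Q = (\<lambda>x. lim (\<lambda>k. P k x))"
  have [measurable]: "P k \<in> borel_measurable M" for k
    using P by (rule square_integrable_measurable)
  have Q_meas [measurable]: "Q \<in> borel_measurable M"
    unfolding Q_def by measurable
  have close: "AE x in M. \<forall>k. (norm (P k x - Q x))\<^sup>2 \<le> 4 * W x * (1 / 4) ^ k"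
    using summ
  proof eventually_elim
    case (elim x)
    have W: "f k x \<le> W x" "0 \<le> W x" for k
      unfolding W_def using elim f_nonneg
      by (auto intro: sum_le_suminf[of "\<lambda>k. f k x" "{k}", simplified] suminf_nonneg)
    have step: "norm (P (Suc k) x - P k x) \<le> sqrt (W x) * (1 / 2) ^ k" for k
    proof (rule power2_le_imp_le)
      have "(norm (P (Suc k) x - P k x))\<^sup>2 \<le> W x / 4 ^ k"
        using W(1)[of k] by (simp add: f_def field_simps)
      also have "\<dots> = (sqrt (W x) * (1 / 2) ^ k)\<^sup>2"
        using W(2) by (simp add: power_mult_distrib power_one_over power2_eq_square
            flip: power_mult_distrib)
      finally show "(norm (P (Suc k) x - P k x))\<^sup>2 \<le> (sqrt (W x) * (1 / 2) ^ k)\<^sup>2" .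
    qed (use W in simp)
    show ?case
    proof
      fix k
      have "norm (P k x - Q x) \<le> 2 * sqrt (W x) * (1 / 2) ^ k"
        unfolding Q_def by (rule geometric_steps_limit(2)[where p = "\<lambda>k. P k x", OF step])
      then have "(norm (P k x - Q x))\<^sup>2 \<le> (2 * sqrt (W x) * (1 / 2) ^ k)\<^sup>2"
        by (intro power_mono) auto
      also have "\<dots> = 4 * W x * (1 / 4) ^ k"
        using W(2) by (simp add: power_mult_distrib power_one_over power2_eq_square
            flip: power_mult_distrib)
      finally show "(norm (P k x - Q x))\<^sup>2 \<le> 4 * W x * (1 / 4) ^ k" .
    qed
  qed
  have int: "integrable M (\<lambda>x. (norm (P k x - Q x))\<^sup>2)" for k
  proof (rule Bochner_Integration.integrable_bound)
    show "integrable M (\<lambda>x. 4 * W x * (1 / 4) ^ k)"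
      using W_int by auto
    show "AE x in M. norm ((norm (P k x - Q x))\<^sup>2) \<le> norm (4 * W x * (1 / 4) ^ k)"
      using close
      by eventually_elim (auto intro: order_trans[OF _ abs_ge_self])
  qed measurable
  have Q: "square_integrable M Q"
    using square_integrable_diff[OF P[of 0], of "\<lambda>x. P 0 x - Q x"] int[of 0]
    by (simp add: square_integrable_def)
  moreover have "(\<lambda>k. sqdist M (P k) Q) \<longlonglongrightarrow> 0"
  proof (rule tendsto_sandwich[where f = "\<lambda>_. 0"])
    show "\<forall>\<^sub>F k in sequentially. sqdist M (P k) Q \<le> 4 * (LINT x|M. W x) * (1 / 4) ^ k"
    proof (intro always_eventually allI)
      fix k
      have "sqdist M (P k) Q \<le> (LINT x|M. 4 * W x * (1 / 4) ^ k)"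
        unfolding sqdist_def using close W_int int
        by (intro integral_mono_AE) (auto elim: eventually_mono)
      also have "\<dots> = 4 * (LINT x|M. W x) * (1 / 4) ^ k"
        by simp
      finally show "sqdist M (P k) Q \<le> 4 * (LINT x|M. W x) * (1 / 4) ^ k" .
    qed
    have "(\<lambda>k. 4 * (LINT x|M. W x) * (1 / 4) ^ k) \<longlonglongrightarrow> 4 * (LINT x|M. W x) * 0"
      by (intro tendsto_intros LIMSEQ_power_zero) simp
    then show "(\<lambda>k. 4 * (LINT x|M. W x) * (1 / 4) ^ k) \<longlonglongrightarrow> 0"
      by simp
  qed (auto simp: sqdist_nonneg)
  ultimately show ?thesis
    using that by blast
qed

text \<open>Riesz--Fischer: a Cauchy sequence converges to the limit of a fast subsequence.\<close>

theorem square_integrable_complete: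
  fixes P :: "nat \<Rightarrow> 'x \<Rightarrow> 'b::euclidean_space"
  assumes P: "\<And>k. square_integrable M (P k)"
    and Cauchy: "\<And>e. e > 0 \<Longrightarrow> \<exists>N. \<forall>m\<ge>N. \<forall>n\<ge>N. sqdist M (P m) (P n) < e"
  obtains Q where "square_integrable M Q" "(\<lambda>k. sqdist M (P k) Q) \<longlonglongrightarrow> 0"
proof -
  have "\<forall>k. \<exists>N. \<forall>m\<ge>N. \<forall>n\<ge>N. sqdist M (P m) (P n) < (1 / 8) ^ k"
    using Cauchy by simp
  then obtain N where N: "\<And>k m n. m \<ge> N k \<Longrightarrow> n \<ge> N k \<Longrightarrow> sqdist M (P m) (P n) < (1 / 8) ^ k"
    by metis
  \<comment> \<open>the sum, rather than \<open>N\<close> itself, makes the indices increasing\<close>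
  define r where "r = (\<lambda>k. \<Sum>i\<le>k. N i)"
  have r: "N k \<le> r k" "r k \<le> r (Suc k)" for k
    by (auto simp: r_def member_le_sum)
  have "sqdist M (P (r (Suc k))) (P (r k)) \<le> (1 / 8) ^ k" for k
    using N[of k] r[of k] by (intro less_imp_le) simp
  then obtain Q where Q: "square_integrable M Q" "(\<lambda>k. sqdist M (P (r k)) Q) \<longlonglongrightarrow> 0"
    using square_integrable_limit_of_fast_Cauchy[of M "\<lambda>k. P (r k)"] P by blast
  have "(\<lambda>k. sqdist M (P k) Q) \<longlonglongrightarrow> 0"
  proof (rule LIMSEQ_I)
    fix e :: real assume e: "e > 0"
    obtain k1 where k1: "\<And>k. k \<ge> k1 \<Longrightarrow> sqdist M (P (r k)) Q < e / 4"
      using LIMSEQ_D[OF Q(2), of "e / 4"] e by (auto simp: sqdist_nonneg)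
    obtain k2 where k2: "(1 / 8 :: real) ^ k2 < e / 4"
      using real_arch_pow_inv[of "e / 4" "1 / 8"] e by auto
    define k where "k = max k1 k2"
    have "(1 / 8 :: real) ^ k \<le> (1 / 8) ^ k2"
      by (intro power_decreasing) (auto simp: k_def)
    then have k: "(1 / 8 :: real) ^ k < e / 4"
      using k2 by linarith
    have "norm (sqdist M (P n) Q - 0) < e" if n: "n \<ge> N k" for n
    proof -
      have "sqdist M (P n) Q \<le> 2 * sqdist M (P n) (P (r k)) + 2 * sqdist M (P (r k)) Q"
        by (rule sqdist_triangle[OF P P Q(1)])
      moreover have "sqdist M (P n) (P (r k)) < e / 4"
        using N[OF n r(1)] k by linarith
      moreover have "sqdist M (P (r k)) Q < e / 4"
        by (rule k1) (simp add: k_def)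
      ultimately show ?thesis
        using sqdist_nonneg[of M "P n" Q] by simp
    qed
    then show "\<exists>n0. \<forall>n\<ge>n0. norm (sqdist M (P n) Q - 0) < e" by blast
  qed
  then show ?thesis
    using that Q(1) by blast
qed

lemma sqdist_eq_0_imp_AE_eq:
  assumes "square_integrable M P" "square_integrable M Q" "sqdist M P Q = 0"
  shows "AE x in M. P x = Q x"
  using assms(3) integral_nonneg_eq_0_iff_AE[OF sqdist_integrable[OF assms(1,2)]]
  by (simp add: sqdist_def)

text \<open>Used for the projections of pairs and for the coordinates of a gradient.\<close>

lemma square_integrable_contraction:
  assumes L: "bounded_linear L" "\<And>y. norm (L y) \<le> norm y" and P: "square_integrable M P"
  shows "square_integrable M (\<lambda>x. L (P x))"
proof -
  have meas: "(\<lambda>x. L (P x)) \<in> borel_measurable M"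
    using borel_measurable_continuous_on[OF linear_continuous_on[OF L(1)] square_integrable_measurable[OF P]] .
  moreover have "integrable M (\<lambda>x. (norm (L (P x)))\<^sup>2)"
  proof (rule Bochner_Integration.integrable_bound)
    show "integrable M (\<lambda>x. (norm (P x))\<^sup>2)"
      using P by (simp add: square_integrable_def)
    show "AE x in M. norm ((norm (L (P x)))\<^sup>2) \<le> norm ((norm (P x))\<^sup>2)"
      using L(2) by (simp add: power_mono)
  qed (use meas in measurable)
  ultimately show ?thesis
    by (simp add: square_integrable_def)
qed

lemma sqdist_contraction:
  assumes L: "bounded_linear L" "\<And>y. norm (L y) \<le> norm y"
    and P: "square_integrable M P" and Q: "square_integrable M Q"
  shows "sqdist M (\<lambda>x. L (P x)) (\<lambda>x. L (Q x)) \<le> sqdist M P Q"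
  unfolding sqdist_def
proof (rule integral_mono)
  show "integrable M (\<lambda>x. (norm (L (P x) - L (Q x)))\<^sup>2)"
    by (rule sqdist_integrable[OF square_integrable_contraction[OF L P] square_integrable_contraction[OF L Q]])
  show "integrable M (\<lambda>x. (norm (P x - Q x))\<^sup>2)"
    by (rule sqdist_integrable[OF P Q])
  show "(norm (L (P x) - L (Q x)))\<^sup>2 \<le> (norm (P x - Q x))\<^sup>2" for x
    using L(2)[of "P x - Q x"] by (simp add: linear_diff[OF bounded_linear.linear[OF L(1)], symmetric] power_mono)
qed

lemma sqdist_contraction_tendsto:
  assumes L: "bounded_linear L" "\<And>y. norm (L y) \<le> norm y"
    and P: "\<And>k. square_integrable M (P k)" and Q: "square_integrable M Q"
    and lim: "(\<lambda>k. sqdist M (P k) Q) \<longlonglongrightarrow> 0"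
  shows "(\<lambda>k. sqdist M (\<lambda>x. L (P k x)) (\<lambda>x. L (Q x))) \<longlonglongrightarrow> 0"
proof (rule tendsto_sandwich[OF _ _ tendsto_const lim])
  show "\<forall>\<^sub>F k in sequentially. sqdist M (\<lambda>x. L (P k x)) (\<lambda>x. L (Q x)) \<le> sqdist M (P k) Q"
    by (intro always_eventually allI sqdist_contraction[OF L P Q])
qed (simp add: sqdist_nonneg)

lemma square_integrable_inner:
  "i \<in> Basis \<Longrightarrow> square_integrable M G \<Longrightarrow> square_integrable M (\<lambda>x. G x \<bullet> i)"
  by (rule square_integrable_contraction[OF bounded_linear_inner_left]) (simp_all add: Basis_le_norm)

text \<open>This is how Young's inequality yields convergence: the error splits into a small multiple of a
  fixed quantity and a large multiple of a quantity tending to zero.\<close>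

lemma tendsto_if_eps_bound:
  fixes a b :: "nat \<Rightarrow> real"
  assumes bound: "\<And>\<epsilon>. \<epsilon> > 0 \<Longrightarrow> \<exists>C. \<forall>k. \<bar>a k - l\<bar> \<le> \<epsilon> * A + C * b k" and b: "b \<longlonglongrightarrow> 0"
  shows "a \<longlonglongrightarrow> l"
proof (rule LIMSEQ_I)
  fix e :: real assume e: "e > 0"
  define \<epsilon> where "\<epsilon> = e / (2 * (\<bar>A\<bar> + 1))"
  have \<epsilon>: "\<epsilon> > 0" "\<epsilon> * A \<le> e / 2"
  proof -
    show "\<epsilon> > 0" using e by (simp add: \<epsilon>_def)
    then have "\<epsilon> * A \<le> \<epsilon> * (\<bar>A\<bar> + 1)" by (intro mult_left_mono) auto
    also have "\<dots> = e / 2" by (simp add: \<epsilon>_def divide_simps)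
    finally show "\<epsilon> * A \<le> e / 2" .
  qed
  obtain C where C: "\<And>k. \<bar>a k - l\<bar> \<le> \<epsilon> * A + C * b k"
    using bound[OF \<epsilon>(1)] by blast
  have "(\<lambda>k. C * b k) \<longlonglongrightarrow> C * 0"
    by (intro tendsto_intros b)
  then obtain N where N: "\<And>k. k \<ge> N \<Longrightarrow> \<bar>C * b k\<bar> < e / 2"
    using LIMSEQ_D[of "\<lambda>k. C * b k" 0 "e / 2"] e by auto
  have "norm (a k - l) < e" if "k \<ge> N" for k
    using N[OF that] C[of k] \<epsilon>(2) unfolding real_norm_def by linarith
  then show "\<exists>n0. \<forall>n\<ge>n0. norm (a n - l) < e" by blast
qed

lemma Young_eps: "\<epsilon> > 0 \<Longrightarrow> a * b \<le> \<epsilon> * a\<^sup>2 + (1 / \<epsilon>) * (b::real)\<^sup>2"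
proof -
  assume e: "\<epsilon> > 0"
  have "0 \<le> (sqrt \<epsilon> * a - b / sqrt \<epsilon>)\<^sup>2 + \<epsilon> * a\<^sup>2 + (1 / \<epsilon>) * b\<^sup>2"
    using e by simp
  also have "\<dots> = 2 * (\<epsilon> * a\<^sup>2 + (1 / \<epsilon>) * b\<^sup>2 - a * b)"
    using e by (simp add: power2_diff power_mult_distrib power_divide)
  finally show ?thesis by simp
qed

lemma (in finite_measure) square_integrable_imp_norm_integrable:
  assumes "square_integrable M P"
  shows "integrable M (\<lambda>x. norm (P x))"
proof (rule square_integrable_imp_integrable)
  show "(\<lambda>x. norm (P x)) \<in> borel_measurable M"
    using square_integrable_measurable[OF assms] by measurable
  show "integrable M (\<lambda>x. (norm (P x))\<^sup>2)"
    using assms by (simp add: square_integrable_def)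
qed

lemma (in finite_measure) integrable_mult_bounded:
  fixes u :: "'a \<Rightarrow> real"
  assumes "square_integrable M u" "\<phi> \<in> borel_measurable M" "\<exists>B. \<forall>x. \<bar>\<phi> x\<bar> \<le> B"
  shows "integrable M (\<lambda>x. u x * \<phi> x)"
proof -
  obtain B where B: "\<And>x. \<bar>\<phi> x\<bar> \<le> B"
    using assms(3) by blast
  show ?thesis
  proof (rule Bochner_Integration.integrable_bound)
    show "integrable M (\<lambda>x. B * norm (u x))"
      using square_integrable_imp_norm_integrable[OF assms(1)] by simp
    show "(\<lambda>x. u x * \<phi> x) \<in> borel_measurable M"
      using square_integrable_measurable[OF assms(1)] assms(2) by simp
    have "norm (u x * \<phi> x) \<le> norm (B * norm (u x))" for x
      using mult_right_mono[OF order_trans[OF B[of x] abs_ge_self], of "\<bar>u x\<bar>"]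
      by (simp add: abs_mult mult.commute)
    then show "AE x in M. norm (u x * \<phi> x) \<le> norm (B * norm (u x))"
      by simp
  qed
qed

lemma (in finite_measure) integral_mult_bounded_tendsto:
  fixes w :: "nat \<Rightarrow> 'a \<Rightarrow> real"
  assumes w: "\<And>k. square_integrable M (w k)" and u: "square_integrable M u"
    and lim: "(\<lambda>k. sqdist M (w k) u) \<longlonglongrightarrow> 0"
    and \<phi>: "\<phi> \<in> borel_measurable M" "\<And>x. \<bar>\<phi> x\<bar> \<le> B"
  shows "(\<lambda>k. LINT x|M. w k x * \<phi> x) \<longlonglongrightarrow> (LINT x|M. u x * \<phi> x)"
proof (rule tendsto_if_eps_bound[OF _ lim])
  fix \<epsilon> :: real assume e: "\<epsilon> > 0"
  have int: "integrable M (\<lambda>x. v x * \<phi> x)" if "square_integrable M v" for v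
    using that \<phi> by (intro integrable_mult_bounded) auto
  show "\<exists>C. \<forall>k. \<bar>(LINT x|M. w k x * \<phi> x) - (LINT x|M. u x * \<phi> x)\<bar>
          \<le> \<epsilon> * (measure M (space M)) + C * sqdist M (w k) u"
  proof (intro exI allI)
    fix k
    have "\<bar>(LINT x|M. w k x * \<phi> x) - (LINT x|M. u x * \<phi> x)\<bar> = \<bar>LINT x|M. (w k x - u x) * \<phi> x\<bar>"
      using int[OF w] int[OF u] by (simp add: left_diff_distrib)
    also have "\<dots> \<le> (LINT x|M. \<bar>(w k x - u x) * \<phi> x\<bar>)"
      by (rule integral_abs_bound)
    also have "\<dots> \<le> (LINT x|M. \<epsilon> + (B\<^sup>2 / \<epsilon>) * (norm (w k x - u x))\<^sup>2)"
    proof (rule integral_mono)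
      show "integrable M (\<lambda>x. \<bar>(w k x - u x) * \<phi> x\<bar>)"
        using int[OF square_integrable_diff[OF w u]] by (rule integrable_abs)
      show "integrable M (\<lambda>x. \<epsilon> + (B\<^sup>2 / \<epsilon>) * (norm (w k x - u x))\<^sup>2)"
        using sqdist_integrable[OF w u] by auto
      fix x
      have "\<bar>(w k x - u x) * \<phi> x\<bar> \<le> 1 * (B * \<bar>w k x - u x\<bar>)"
        using \<phi>(2) by (auto simp: abs_mult mult.commute[of B] intro!: mult_left_mono)
      also have "\<dots> \<le> \<epsilon> * 1\<^sup>2 + (1 / \<epsilon>) * (B * \<bar>w k x - u x\<bar>)\<^sup>2"
        by (rule Young_eps[OF e])
      finally show "\<bar>(w k x - u x) * \<phi> x\<bar> \<le> \<epsilon> + (B\<^sup>2 / \<epsilon>) * (norm (w k x - u x))\<^sup>2"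
        by (simp add: power_mult_distrib)
    qed
    also have "\<dots> = \<epsilon> * measure M (space M) + (B\<^sup>2 / \<epsilon>) * sqdist M (w k) u"
      using sqdist_integrable[OF w u] by (simp add: sqdist_def)
    finally show "\<bar>(LINT x|M. w k x * \<phi> x) - (LINT x|M. u x * \<phi> x)\<bar>
      \<le> \<epsilon> * (measure M (space M)) + (B\<^sup>2 / \<epsilon>) * sqdist M (w k) u" .
  qed
qed

lemma (in finite_measure) integrable_lipschitz_gradient:
  fixes h :: "'b::euclidean_space \<Rightarrow> real"
  assumes h: "is_gradient h Dh" "l-lipschitz_on UNIV Dh" and P: "square_integrable M P"
  shows "integrable M (\<lambda>x. h (P x))"
proof (rule Bochner_Integration.integrable_bound)
  show "integrable M (\<lambda>x. \<bar>h 0\<bar> + norm (Dh 0) * norm (P x) + l / 2 * (norm (P x))\<^sup>2)"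
    using P square_integrable_imp_norm_integrable[OF P] by (auto simp: square_integrable_def)
  show "(\<lambda>x. h (P x)) \<in> borel_measurable M"
    using P borel_measurable_continuous_on[OF is_gradient_imp_continuous_on[OF h(1)]]
    by (auto simp: square_integrable_def)
  show "AE x in M. norm (h (P x)) \<le> norm (\<bar>h 0\<bar> + norm (Dh 0) * norm (P x) + l / 2 * (norm (P x))\<^sup>2)"
  proof (rule AE_I2)
    fix x
    show "norm (h (P x)) \<le> norm (\<bar>h 0\<bar> + norm (Dh 0) * norm (P x) + l / 2 * (norm (P x))\<^sup>2)"
      using gradient_lipschitz_bound[OF h, of "P x" 0] Cauchy_Schwarz_ineq2[of "Dh 0" "P x"]
      unfolding real_norm_def diff_0_right by linarith
  qed
qed

text \<open>The first-order term of \<open>h(P\<^sub>k) - h(Q)\<close> is a product of \<open>|Dh(Q)|\<close>, square integrable by the linear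
  growth of the gradient, and \<open>|P\<^sub>k - Q|\<close>; Young's inequality separates the two.\<close>

lemma (in finite_measure) lipschitz_gradient_functional_tendsto:
  fixes h :: "'b::euclidean_space \<Rightarrow> real"
  assumes h: "is_gradient h Dh" "l-lipschitz_on UNIV Dh"
    and P: "\<And>k. square_integrable M (P k)" and Q: "square_integrable M Q"
    and lim: "(\<lambda>k. sqdist M (P k) Q) \<longlonglongrightarrow> 0"
  shows "(\<lambda>k. LINT x|M. h (P k x)) \<longlonglongrightarrow> (LINT x|M. h (Q x))"
proof (rule tendsto_if_eps_bound[OF _ lim])
  fix \<epsilon> :: real assume e: "\<epsilon> > 0"
  have int: "integrable M (\<lambda>x. h (P k x))" "integrable M (\<lambda>x. h (Q x))" for k
    using integrable_lipschitz_gradient[OF h] P Q by auto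
  have Dh: "integrable M (\<lambda>x. (norm (Dh (Q x)))\<^sup>2)"
  proof (rule Bochner_Integration.integrable_bound)
    show "integrable M (\<lambda>x. 2 * (norm (Dh 0))\<^sup>2 + 2 * (l\<^sup>2 * (norm (Q x))\<^sup>2))"
      using Q by (auto simp: square_integrable_def)
    have "Dh \<in> borel_measurable borel"
      using lipschitz_on_continuous_on[OF h(2)] by (rule borel_measurable_continuous_onI)
    then show "(\<lambda>x. (norm (Dh (Q x)))\<^sup>2) \<in> borel_measurable M"
      using Q by (auto simp: square_integrable_def)
    have "(norm (Dh p))\<^sup>2 \<le> 2 * (norm (Dh 0))\<^sup>2 + 2 * (l\<^sup>2 * (norm p)\<^sup>2)" for p
    proof -
      have "norm (Dh p - Dh 0) \<le> l * norm p"
        using lipschitz_onD[OF h(2), of p 0] by (simp add: dist_norm)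
      then have "(norm (Dh p - Dh 0))\<^sup>2 \<le> l\<^sup>2 * (norm p)\<^sup>2"
        by (metis norm_ge_zero power_mono power_mult_distrib)
      then show ?thesis
        using power2_norm_add_le[of "Dh 0" "Dh p - Dh 0"] by simp
    qed
    then show "AE x in M. norm ((norm (Dh (Q x)))\<^sup>2) \<le> norm (2 * (norm (Dh 0))\<^sup>2 + 2 * (l\<^sup>2 * (norm (Q x))\<^sup>2))"
      by simp
  qed
  show "\<exists>C. \<forall>k. \<bar>(LINT x|M. h (P k x)) - (LINT x|M. h (Q x))\<bar>
      \<le> \<epsilon> * (LINT x|M. (norm (Dh (Q x)))\<^sup>2) + C * sqdist M (P k) Q"
  proof (intro exI allI)
    fix k
    have "\<bar>(LINT x|M. h (P k x)) - (LINT x|M. h (Q x))\<bar> = \<bar>LINT x|M. h (P k x) - h (Q x)\<bar>"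
      using int by simp
    also have "\<dots> \<le> (LINT x|M. \<bar>h (P k x) - h (Q x)\<bar>)"
      by (rule integral_abs_bound)
    also have "\<dots> \<le> (LINT x|M. \<epsilon> * (norm (Dh (Q x)))\<^sup>2 + (1 / \<epsilon> + l / 2) * (norm (P k x - Q x))\<^sup>2)"
    proof (rule integral_mono)
      show "integrable M (\<lambda>x. \<bar>h (P k x) - h (Q x)\<bar>)"
        using int by auto
      show "integrable M (\<lambda>x. \<epsilon> * (norm (Dh (Q x)))\<^sup>2 + (1 / \<epsilon> + l / 2) * (norm (P k x - Q x))\<^sup>2)"
        using sqdist_integrable[OF P Q] Dh by auto
      fix x
      show "\<bar>h (P k x) - h (Q x)\<bar> \<le> \<epsilon> * (norm (Dh (Q x)))\<^sup>2 + (1 / \<epsilon> + l / 2) * (norm (P k x - Q x))\<^sup>2"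
        using gradient_lipschitz_bound[OF h, of "P k x" "Q x"]
          Cauchy_Schwarz_ineq2[of "Dh (Q x)" "P k x - Q x"]
          Young_eps[OF e, of "norm (Dh (Q x))" "norm (P k x - Q x)"]
        unfolding distrib_right by linarith
    qed
    also have "\<dots> = \<epsilon> * (LINT x|M. (norm (Dh (Q x)))\<^sup>2) + (1 / \<epsilon> + l / 2) * sqdist M (P k) Q"
      using sqdist_integrable[OF P Q] Dh by (simp add: sqdist_def)
    finally show "\<bar>(LINT x|M. h (P k x)) - (LINT x|M. h (Q x))\<bar>
      \<le> \<epsilon> * (LINT x|M. (norm (Dh (Q x)))\<^sup>2) + (1 / \<epsilon> + l / 2) * sqdist M (P k) Q" .
  qed
qed

section \<open>Smooth cutoff functions and the fundamental lemma of the calculus of variations\<close>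

text \<open>The functions \<open>p(1/t) exp(-1/t)\<close> for polynomials \<open>p\<close>, extended by \<open>0\<close> to \<open>t \<le> 0\<close>. The standard smooth
  non-analytic function is the case \<open>p = 1\<close>; with all \<open>p\<close> admitted, the family is closed under
  differentiation.\<close>

definition flat :: "real poly \<Rightarrow> real \<Rightarrow> real" where
  "flat p t = (if t > 0 then poly p (1 / t) * exp (- 1 / t) else 0)"

lemma poly_div_exp_tendsto_0: "((\<lambda>s::real. poly p s / exp s) \<longlongrightarrow> 0) at_top"
proof -
  have "((\<lambda>s::real. \<Sum>i\<le>degree p. coeff p i * (s ^ i / exp s)) \<longlongrightarrow> (\<Sum>i\<le>degree p. coeff p i * 0)) at_top"
    by (intro tendsto_intros tendsto_power_div_exp_0)
  then show ?thesis
    by (simp add: poly_altdef sum_divide_distrib)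
qed

lemma flat_tendsto_0: "(flat p \<longlongrightarrow> 0) (at 0)"
proof -
  have "((\<lambda>t. poly p (inverse t) / exp (inverse t)) \<longlongrightarrow> 0) (at_right 0)"
    by (rule filterlim_compose[OF poly_div_exp_tendsto_0 filterlim_inverse_at_top_right])
  then have "(flat p \<longlongrightarrow> 0) (at_right 0)"
    by (rule Lim_transform_eventually)
       (auto simp: eventually_at_right_field flat_def exp_minus divide_simps intro!: exI[of _ 1])
  moreover have "(flat p \<longlongrightarrow> 0) (at_left 0)"
    by (rule tendsto_eventually) (auto simp: eventually_at_left_field flat_def intro!: exI[of _ "-1"])
  ultimately show ?thesis
    by (simp add: filterlim_split_at)
qed

lemma flat_has_field_derivative:
  "(flat p has_field_derivative flat (pCons 0 (pCons 0 (p - pderiv p))) t) (at t)"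
proof -
  consider "t > 0" | "t < 0" | "t = 0" by linarith
  then show ?thesis
  proof cases
    case 1
    have "((\<lambda>t. poly p (1 / t) * exp (- 1 / t)) has_field_derivative
            flat (pCons 0 (pCons 0 (p - pderiv p))) t) (at t)"
      using 1 by (auto intro!: derivative_eq_intros DERIV_chain'[OF _ poly_DERIV] simp: flat_def field_simps)
    then show ?thesis
      by (rule has_field_derivative_transform_within_open[where S = "{0<..}"]) (use 1 in \<open>auto simp: flat_def\<close>)
  next
    case 2
    have "((\<lambda>t. 0) has_field_derivative flat (pCons 0 (pCons 0 (p - pderiv p))) t) (at t)"
      using 2 by (simp add: flat_def)
    then show ?thesis
      by (rule has_field_derivative_transform_within_open[where S = "{..<0}"]) (use 2 in \<open>auto simp: flat_def\<close>)
  next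
    case 3
    have "((\<lambda>h. (flat p h - flat p 0) / h) \<longlongrightarrow> 0) (at 0)"
      by (rule Lim_transform_eventually[OF flat_tendsto_0[of "pCons 0 p"]])
         (auto simp: eventually_at flat_def intro!: exI[of _ 1])
    then show ?thesis
      using 3 by (simp add: DERIV_def flat_def)
  qed
qed

text \<open>A set of functions that contains the partial derivatives of its members consists of smooth
  functions. This one is generated by flat functions of affine functions, and contains the cutoff
  functions of boxes below.\<close>

inductive_set flat_algebra :: "('a::euclidean_space \<Rightarrow> real) set" where
  const: "(\<lambda>x. c) \<in> flat_algebra"
| flat: "(\<lambda>x. flat p (x \<bullet> w + e)) \<in> flat_algebra"
| add: "\<phi> \<in> flat_algebra \<Longrightarrow> \<psi> \<in> flat_algebra \<Longrightarrow> (\<lambda>x. \<phi> x + \<psi> x) \<in> flat_algebra"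
| mult: "\<phi> \<in> flat_algebra \<Longrightarrow> \<psi> \<in> flat_algebra \<Longrightarrow> (\<lambda>x. \<phi> x * \<psi> x) \<in> flat_algebra"

lemma flat_algebra_has_derivative:
  "\<phi> \<in> flat_algebra \<Longrightarrow>
    \<exists>D. (\<forall>x. (\<phi> has_derivative D x) (at x)) \<and> (\<forall>j. (\<lambda>x. D x j) \<in> flat_algebra)"
proof (induction rule: flat_algebra.induct)
  case (const c)
  show ?case
    by (rule exI[of _ "\<lambda>x h. 0"]) (auto intro: flat_algebra.const)
next
  case (flat p w e)
  let ?q = "pCons 0 (pCons 0 (p - pderiv p))"
  have "((\<lambda>x. flat p (x \<bullet> w + e)) has_derivative (\<lambda>h. (h \<bullet> w) * flat ?q (x \<bullet> w + e))) (at x)" for x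
    by (rule has_derivative_eq_rhs[OF DERIV_compose_FDERIV[OF flat_has_field_derivative]])
       (auto intro!: derivative_eq_intros)
  then show ?case
    by (intro exI[of _ "\<lambda>x h. (h \<bullet> w) * flat ?q (x \<bullet> w + e)"])
       (auto intro: flat_algebra.intros)
next
  case (add \<phi> \<psi>)
  then obtain D E where "\<forall>x. (\<phi> has_derivative D x) (at x)" "\<forall>j. (\<lambda>x. D x j) \<in> flat_algebra"
    "\<forall>x. (\<psi> has_derivative E x) (at x)" "\<forall>j. (\<lambda>x. E x j) \<in> flat_algebra"
    by blast
  then show ?case
    by (intro exI[of _ "\<lambda>x h. D x h + E x h"])
       (auto intro: flat_algebra.intros has_derivative_add)
next
  case (mult \<phi> \<psi>)
  then obtain D E where "\<forall>x. (\<phi> has_derivative D x) (at x)" "\<forall>j. (\<lambda>x. D x j) \<in> flat_algebra"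
    "\<forall>x. (\<psi> has_derivative E x) (at x)" "\<forall>j. (\<lambda>x. E x j) \<in> flat_algebra"
    by blast
  then show ?case
    using mult.hyps
    by (intro exI[of _ "\<lambda>x h. \<phi> x * E x h + D x h * \<psi> x"])
       (auto intro!: flat_algebra.add flat_algebra.mult has_derivative_mult)
qed

lemma flat_algebra_C_k: "\<phi> \<in> flat_algebra \<Longrightarrow> C_k k \<phi>"
proof (induction k arbitrary: \<phi>)
  case 0
  then obtain D where "\<forall>x. (\<phi> has_derivative D x) (at x)"
    using flat_algebra_has_derivative by blast
  then show ?case
    by (auto intro!: continuous_at_imp_continuous_on has_derivative_continuous)
next
  case (Suc k)
  then obtain D where D: "\<forall>x. (\<phi> has_derivative D x) (at x)" "\<forall>j. (\<lambda>x. D x j) \<in> flat_algebra"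
    using flat_algebra_has_derivative by blast
  then have "frechet_derivative \<phi> (at x) = D x" for x
    by (metis frechet_derivative_at)
  with D Suc.IH show ?case
    by (auto simp: differentiable_def)
qed

lemma flat_algebra_prod:
  "finite I \<Longrightarrow> (\<And>i. i \<in> I \<Longrightarrow> \<phi> i \<in> flat_algebra) \<Longrightarrow> (\<lambda>x. \<Prod>i\<in>I. \<phi> i x) \<in> flat_algebra"
  by (induction I rule: finite_induct) (auto intro: flat_algebra.intros)

text \<open>Positive exactly on \<open>box a b\<close> if \<open>k > 0\<close>. Increasing \<open>k\<close> drives every factor \<open>exp (- 1 / (k s))\<close> to \<open>1\<close>, so that
  test functions converge boundedly to the indicator of the box.\<close>

definition bump :: "'a::euclidean_space \<Rightarrow> 'a \<Rightarrow> real \<Rightarrow> 'a \<Rightarrow> real" where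
  "bump a b k x = (\<Prod>i\<in>Basis. flat 1 (k * (x \<bullet> i - a \<bullet> i)) * flat 1 (k * (b \<bullet> i - x \<bullet> i)))"

lemma flat_1_bounds: "0 \<le> flat 1 t" "flat 1 t \<le> 1"
  by (auto simp: flat_def)

lemma bump_bounds: "0 \<le> bump a b k x" "bump a b k x \<le> 1"
  unfolding bump_def
  by (auto intro!: prod_nonneg prod_le_1 mult_nonneg_nonneg mult_le_one simp: flat_1_bounds)

lemma bump_eq_0:
  assumes "k > 0" "x \<notin> box a b"
  shows "bump a b k x = 0"
proof -
  obtain i where i: "i \<in> Basis" "\<not> (a \<bullet> i < x \<bullet> i \<and> x \<bullet> i < b \<bullet> i)"
    using assms(2) by (auto simp: mem_box)
  then have "flat 1 (k * (x \<bullet> i - a \<bullet> i)) * flat 1 (k * (b \<bullet> i - x \<bullet> i)) = 0"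
    using assms(1) by (auto simp: flat_def zero_less_mult_iff)
  then show ?thesis
    unfolding bump_def using i(1) by (meson finite_Basis prod_zero)
qed

lemma bump_in_test_functions:
  assumes "k > 0" "cbox a b \<subseteq> \<Omega>"
  shows "bump a b k \<in> test_functions \<Omega>"
proof -
  have "(\<lambda>x. \<Prod>i\<in>Basis. flat 1 (x \<bullet> (k *\<^sub>R i) + - k * (a \<bullet> i)) * flat 1 (x \<bullet> (- k *\<^sub>R i) + k * (b \<bullet> i)))
          \<in> flat_algebra"
    by (intro flat_algebra_prod flat_algebra.mult flat_algebra.flat) simp
  then have "bump a b k \<in> flat_algebra"
    by (simp add: bump_def[abs_def] algebra_simps)
  moreover have "{x. bump a b k x \<noteq> 0} \<subseteq> cbox a b"
    using bump_eq_0[OF assms(1)] box_subset_cbox by blast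
  then have "closure {x. bump a b k x \<noteq> 0} \<subseteq> cbox a b"
    by (intro closure_minimal) auto
  moreover from this have "compact (closure {x. bump a b k x \<noteq> 0})"
    by (meson bounded_cbox bounded_subset closed_closure compact_eq_bounded_closed)
  ultimately show ?thesis
    using assms(2) flat_algebra_C_k by (auto simp: test_functions_def)
qed

lemma bump_tendsto_indicator: "(\<lambda>k. bump a b (real (Suc k)) x) \<longlonglongrightarrow> indicator (box a b) x"
proof (cases "x \<in> box a b")
  case True
  have *: "(\<lambda>k. flat 1 (real (Suc k) * t)) \<longlonglongrightarrow> 1" if "t > 0" for t
  proof -
    have "(\<lambda>k. exp (- (1 / t) * inverse (real (Suc k)))) \<longlonglongrightarrow> exp (- (1 / t) * 0)"
      by (intro tendsto_intros LIMSEQ_inverse_real_of_nat)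
    moreover have "flat 1 (real (Suc k) * t) = exp (- (1 / t) * inverse (real (Suc k)))" for k
      using that by (simp add: flat_def divide_simps zero_less_mult_iff)
    ultimately show ?thesis by simp
  qed
  have "(\<lambda>k. bump a b (real (Suc k)) x) \<longlonglongrightarrow> (\<Prod>i\<in>(Basis :: 'a set). 1 * 1)"
    unfolding bump_def by (intro tendsto_prod tendsto_mult *) (use True in \<open>auto simp: mem_box\<close>)
  then show ?thesis
    using True by simp
next
  case False
  then show ?thesis by (simp add: bump_eq_0)
qed

lemma integral_box_eq_0:
  assumes "open \<Omega>" and w: "integrable (lebesgue_on \<Omega>) w"
    and orth: "\<And>\<phi>. \<phi> \<in> test_functions \<Omega> \<Longrightarrow> (LINT x|lebesgue_on \<Omega>. w x * \<phi> x) = 0"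
    and sub: "cbox a b \<subseteq> \<Omega>"
  shows "(LINT x|lebesgue_on \<Omega>. w x * indicator (box a b) x) = (0::real)"
proof -
  have meas: "bump a b (real (Suc k)) \<in> borel_measurable (lebesgue_on \<Omega>)" for k
  proof -
    have "bump a b (real (Suc k)) \<in> test_functions \<Omega>"
      using bump_in_test_functions sub by (metis of_nat_0_less_iff zero_less_Suc)
    then have "C_k 0 (bump a b (real (Suc k)))"
      unfolding test_functions_def by blast
    then show ?thesis
      by (simp add: borel_measurable_continuous_onI measurable_completion measurable_restrict_space1)
  qed
  have "(\<lambda>k. LINT x|lebesgue_on \<Omega>. w x * bump a b (real (Suc k)) x)
          \<longlonglongrightarrow> (LINT x|lebesgue_on \<Omega>. w x * indicator (box a b) x)"
  proof (rule integral_dominated_convergence)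
    show "(\<lambda>x. w x * indicator (box a b) x) \<in> borel_measurable (lebesgue_on \<Omega>)"
      by (intro borel_measurable_times borel_measurable_integrable[OF w] borel_measurable_indicator'
            measurable_restrict_space1) auto
    show "(\<lambda>x. w x * bump a b (real (Suc k)) x) \<in> borel_measurable (lebesgue_on \<Omega>)" for k
      using meas w by auto
    show "integrable (lebesgue_on \<Omega>) (\<lambda>x. norm (w x))"
      using w by auto
    show "AE x in lebesgue_on \<Omega>. (\<lambda>k. w x * bump a b (real (Suc k)) x)
            \<longlonglongrightarrow> w x * indicator (box a b) x"
      by (intro AE_I2 tendsto_intros bump_tendsto_indicator)
    show "AE x in lebesgue_on \<Omega>. norm (w x * bump a b (real (Suc k)) x) \<le> norm (w x)" for k
      using bump_bounds[of a b "real (Suc k)"]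
      by (intro AE_I2) (simp add: abs_mult mult_left_le)
  qed
  moreover have "(LINT x|lebesgue_on \<Omega>. w x * bump a b (real (Suc k)) x) = 0" for k
    using orth bump_in_test_functions sub by (metis of_nat_0_less_iff zero_less_Suc)
  ultimately show ?thesis
    by (simp add: LIMSEQ_const_iff)
qed

text \<open>The integral of \<open>w\<close> over every box inside \<open>\<Omega>\<close> vanishes, and at almost every point \<open>w\<close> is the limit
  of its averages over small cubes.\<close>

lemma AE_eq_0_if_orthogonal_to_test_functions:
  fixes w :: "'a::euclidean_space \<Rightarrow> real"
  assumes "open \<Omega>" and w: "integrable (lebesgue_on \<Omega>) w"
    and orth: "\<And>\<phi>. \<phi> \<in> test_functions \<Omega> \<Longrightarrow> (LINT x|lebesgue_on \<Omega>. w x * \<phi> x) = 0"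
  shows "AE x in lebesgue_on \<Omega>. w x = 0"
proof -
  define F where "F = (\<lambda>x. indicator \<Omega> x * w x)"
  have \<Omega>: "\<Omega> \<in> sets lebesgue"
    using assms(1) by (simp add: borel_open)
  have F: "integrable lebesgue F"
    using w \<Omega> by (simp add: F_def integrable_restrict_space)
  have int: "F integrable_on cbox a b" for a b
    using integrable_on_subcbox[OF integrable_on_lebesgue[OF F]] by blast
  obtain N where N: "negligible N"
    "\<And>x e. x \<notin> N \<Longrightarrow> 0 < e \<Longrightarrow> \<exists>d>0. \<forall>h. 0 < h \<and> h < d \<longrightarrow>
        norm (integral (cbox x (x + h *\<^sub>R One)) F /\<^sub>R h ^ DIM('a) - F x) < e"
    using integrable_ccontinuous_explicit[OF int] by blast
  have zero: "integral (cbox a b) F = 0" if "cbox a b \<subseteq> \<Omega>" for a b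
  proof -
    have "integrable (lebesgue_on (box a b)) F"
      using F by (intro integrable_restrict_space[THEN iffD2] integrable_mult_indicator) auto
    then have "integral (box a b) F = (LINT x|lebesgue_on (box a b). F x)"
      by (simp add: lebesgue_integral_eq_integral)
    also have "\<dots> = (LINT x|lebesgue. indicator \<Omega> x *\<^sub>R (w x * indicator (box a b) x))"
      by (simp add: integral_restrict_space F_def mult_ac)
    also have "\<dots> = (LINT x|lebesgue_on \<Omega>. w x * indicator (box a b) x)"
      using \<Omega> by (simp add: integral_restrict_space)
    also have "\<dots> = 0"
      using integral_box_eq_0[OF assms that] .
    finally show ?thesis
      by (simp add: integral_open_interval)
  qed
  have "w x = 0" if x: "x \<in> \<Omega>" "x \<notin> N" for x
  proof (rule ccontr)
    assume "w x \<noteq> 0"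
    then obtain d where d: "d > 0" "\<And>h. 0 < h \<Longrightarrow> h < d \<Longrightarrow>
        norm (integral (cbox x (x + h *\<^sub>R One)) F /\<^sub>R h ^ DIM('a) - F x) < \<bar>w x\<bar>"
      using N(2)[OF x(2), of "\<bar>w x\<bar>"] by auto
    obtain e where e: "e > 0" "cball x e \<subseteq> \<Omega>"
      using open_contains_cball assms(1) x(1) by blast
    define h where "h = min (d / 2) (e / DIM('a))"
    have h: "h > 0" "h < d" "h * DIM('a) \<le> e"
      using d(1) e(1) by (auto simp: h_def min_def field_simps)
    have "cbox x (x + h *\<^sub>R One) \<subseteq> cball x e"
    proof
      fix y assume y: "y \<in> cbox x (x + h *\<^sub>R One)"
      have "norm (y - x) \<le> (\<Sum>i\<in>Basis. \<bar>(y - x) \<bullet> i\<bar>)"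
        by (rule norm_le_l1)
      also have "\<dots> \<le> (\<Sum>i\<in>(Basis::'a set). h)"
        using y by (intro sum_mono) (fastforce simp: mem_box inner_diff_left inner_add_left abs_le_iff)
      finally show "y \<in> cball x e"
        using h(3) by (simp add: dist_norm norm_minus_commute mult.commute)
    qed
    then have "integral (cbox x (x + h *\<^sub>R One)) F = 0"
      using zero e(2) by blast
    then show False
      using d(2)[OF h(1,2)] x(1) by (simp add: F_def)
  qed
  then have "{x \<in> space lebesgue. \<not> (x \<in> \<Omega> \<longrightarrow> w x = 0)} \<subseteq> N" by auto
  moreover have "N \<in> null_sets lebesgue"
    using N(1) negligible_iff_null_sets by blast
  ultimately have "AE x in lebesgue. x \<in> \<Omega> \<longrightarrow> w x = 0"
    by (rule AE_I'[rotated])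
  then show ?thesis
    using \<Omega> by (simp add: AE_restrict_space_iff)
qed

section \<open>Weak gradients and closed subspaces of H1\<close>

lemma L2_iff_square_integrable: "u \<in> L2 \<Omega> \<longleftrightarrow> square_integrable (lebesgue_on \<Omega>) u"
  by (simp add: L2_def square_integrable_def)

lemma bounded_if_zero_outside_compact:
  fixes \<psi> :: "'a::euclidean_space \<Rightarrow> real"
  assumes "continuous_on UNIV \<psi>" "compact K" "\<And>x. x \<notin> K \<Longrightarrow> \<psi> x = 0"
  shows "\<exists>B. \<forall>x. \<bar>\<psi> x\<bar> \<le> B"
proof -
  have "compact (\<psi> ` K)"
    using assms(1,2) by (intro compact_continuous_image) (auto intro: continuous_on_subset)
  then obtain B where B: "B > 0" "\<And>x. x \<in> K \<Longrightarrow> \<bar>\<psi> x\<bar> \<le> B"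
    using compact_imp_bounded[of "\<psi> ` K"] by (auto simp: bounded_pos)
  then have "\<bar>\<psi> x\<bar> \<le> B" for x
    using assms(3)[of x] by (cases "x \<in> K") auto
  then show ?thesis by blast
qed

lemma continuous_imp_measurable_lebesgue_on:
  fixes \<psi> :: "'a::euclidean_space \<Rightarrow> real"
  shows "continuous_on UNIV \<psi> \<Longrightarrow> \<psi> \<in> borel_measurable (lebesgue_on \<Omega>)"
  by (intro measurable_restrict_space1 measurable_completion) (simp add: borel_measurable_continuous_onI)

lemma test_function_bounded_measurable:
  assumes "\<phi> \<in> test_functions \<Omega>"
  shows "\<phi> \<in> borel_measurable (lebesgue_on \<Omega>)" "\<exists>B. \<forall>x. \<bar>\<phi> x\<bar> \<le> B"
proof -
  have C: "C_k 0 \<phi>" and K: "compact (closure {x. \<phi> x \<noteq> 0})"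
    using assms unfolding test_functions_def by blast+
  then show "\<phi> \<in> borel_measurable (lebesgue_on \<Omega>)"
    by (intro continuous_imp_measurable_lebesgue_on) simp
  show "\<exists>B. \<forall>x. \<bar>\<phi> x\<bar> \<le> B"
    using C closure_subset[of "{x. \<phi> x \<noteq> 0}"]
    by (intro bounded_if_zero_outside_compact[OF _ K]) auto
qed

lemma test_function_derivative_bounded_measurable:
  assumes "\<phi> \<in> test_functions \<Omega>" "i \<in> Basis"
  shows "(\<lambda>x. frechet_derivative \<phi> (at x) i) \<in> borel_measurable (lebesgue_on \<Omega>)"
    "\<exists>B. \<forall>x. \<bar>frechet_derivative \<phi> (at x) i\<bar> \<le> B"
proof -
  have C: "C_k (Suc 0) \<phi>" and K: "compact (closure {x. \<phi> x \<noteq> 0})"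
    using assms unfolding test_functions_def by blast+
  then have cont: "continuous_on UNIV (\<lambda>x. frechet_derivative \<phi> (at x) i)"
    using assms(2) by simp
  then show "(\<lambda>x. frechet_derivative \<phi> (at x) i) \<in> borel_measurable (lebesgue_on \<Omega>)"
    by (rule continuous_imp_measurable_lebesgue_on)
  show "\<exists>B. \<forall>x. \<bar>frechet_derivative \<phi> (at x) i\<bar> \<le> B"
  proof (rule bounded_if_zero_outside_compact[OF cont K])
    fix x assume x: "x \<notin> closure {x. \<phi> x \<noteq> 0}"
    have "(\<phi> has_derivative (\<lambda>h. 0)) (at x)"
    proof (rule has_derivative_transform_within_open)
      show "((\<lambda>x. 0) has_derivative (\<lambda>h. 0)) (at x)" by simp
      show "open (- closure {x. \<phi> x \<noteq> 0})" by (rule open_Compl) simp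
      show "x \<in> - closure {x. \<phi> x \<noteq> 0}" using x by simp
      show "0 = \<phi> y" if "y \<in> - closure {x. \<phi> x \<noteq> 0}" for y
        using that closure_subset[of "{x. \<phi> x \<noteq> 0}"] by auto
    qed
    then show "frechet_derivative \<phi> (at x) i = 0"
      by (metis frechet_derivative_at)
  qed
qed

lemma finite_measure_lebesgue_on_bounded:
  assumes "open \<Omega>" "bounded \<Omega>"
  shows "finite_measure (lebesgue_on \<Omega>)"
  using assms by (intro finite_measure_lebesgue_on bounded_set_imp_lmeasurable)
    (simp_all add: borel_open)

lemma has_weak_gradient_linear:
  assumes "open \<Omega>" "bounded \<Omega>"
    and u: "u \<in> L2 \<Omega>" "G \<in> L2 \<Omega>" "has_weak_gradient \<Omega> u G"
    and v: "v \<in> L2 \<Omega>" "K \<in> L2 \<Omega>" "has_weak_gradient \<Omega> v K"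
  shows "has_weak_gradient \<Omega> (\<lambda>x. a * u x + b * v x) (\<lambda>x. a *\<^sub>R G x + b *\<^sub>R K x)"
  unfolding has_weak_gradient_def
proof (intro ballI)
  fix \<phi> :: "'a \<Rightarrow> real" and i :: 'a assume \<phi>: "\<phi> \<in> test_functions \<Omega>" and i: "i \<in> Basis"
  interpret finite_measure "lebesgue_on \<Omega>"
    by (rule finite_measure_lebesgue_on_bounded) fact+
  let ?M = "lebesgue_on \<Omega>" and ?d = "\<lambda>x. frechet_derivative \<phi> (at x) i"
  note sq = u(1,2) v(1,2)
  note sq = sq[unfolded L2_iff_square_integrable]
  note int =
    integrable_mult_bounded[OF sq(1) test_function_derivative_bounded_measurable[OF \<phi> i]]
    integrable_mult_bounded[OF sq(3) test_function_derivative_bounded_measurable[OF \<phi> i]]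
    integrable_mult_bounded[OF square_integrable_inner[OF i sq(2)] test_function_bounded_measurable[OF \<phi>]]
    integrable_mult_bounded[OF square_integrable_inner[OF i sq(4)] test_function_bounded_measurable[OF \<phi>]]
  have "(LINT x|?M. (a * u x + b * v x) * ?d x) = (LINT x|?M. a * (u x * ?d x) + b * (v x * ?d x))"
    by (simp add: algebra_simps)
  also have "\<dots> = a * (LINT x|?M. u x * ?d x) + b * (LINT x|?M. v x * ?d x)"
    by (simp add: int)
  also have "\<dots> = - (a * (LINT x|?M. (G x \<bullet> i) * \<phi> x) + b * (LINT x|?M. (K x \<bullet> i) * \<phi> x))"
    using u(3) v(3) \<phi> i by (simp add: has_weak_gradient_def)
  also have "\<dots> = - (LINT x|?M. a * ((G x \<bullet> i) * \<phi> x) + b * ((K x \<bullet> i) * \<phi> x))"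
    by (simp add: int)
  also have "\<dots> = - (LINT x|?M. ((a *\<^sub>R G x + b *\<^sub>R K x) \<bullet> i) * \<phi> x)"
    by (simp add: algebra_simps inner_add_left)
  finally show "(LINT x|?M. (a * u x + b * v x) * ?d x) = - (LINT x|?M. ((a *\<^sub>R G x + b *\<^sub>R K x) \<bullet> i) * \<phi> x)" .
qed

text \<open>Every coordinate of the difference of two weak gradients is orthogonal to all test functions.\<close>

lemma has_weak_gradient_unique:
  fixes u :: "'a::euclidean_space \<Rightarrow> real"
  assumes \<Omega>: "open \<Omega>" "bounded \<Omega>"
    and G: "G \<in> L2 \<Omega>" "has_weak_gradient \<Omega> u G"
    and K: "K \<in> L2 \<Omega>" "has_weak_gradient \<Omega> u K"
  shows "AE x in lebesgue_on \<Omega>. G x = K x"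
proof -
  interpret finite_measure "lebesgue_on \<Omega>"
    by (rule finite_measure_lebesgue_on_bounded[OF \<Omega>])
  let ?M = "lebesgue_on \<Omega>"
  have "AE x in ?M. G x \<bullet> i - K x \<bullet> i = 0" if i: "i \<in> Basis" for i
  proof (rule AE_eq_0_if_orthogonal_to_test_functions[OF \<Omega>(1)])
    have sq: "square_integrable ?M (\<lambda>x. G x \<bullet> i)" "square_integrable ?M (\<lambda>x. K x \<bullet> i)"
      using G(1) K(1) by (auto simp: L2_iff_square_integrable square_integrable_inner[OF i])
    then show "integrable ?M (\<lambda>x. G x \<bullet> i - K x \<bullet> i)"
      using integrable_mult_bounded[OF square_integrable_diff[OF sq], of "\<lambda>_. 1"] by auto
    fix \<phi> assume \<phi>: "\<phi> \<in> test_functions \<Omega>"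
    have "(LINT x|?M. (G x \<bullet> i) * \<phi> x) = (LINT x|?M. (K x \<bullet> i) * \<phi> x)"
      using G(2)[unfolded has_weak_gradient_def, rule_format, OF \<phi> i]
        K(2)[unfolded has_weak_gradient_def, rule_format, OF \<phi> i] by simp
    then show "(LINT x|?M. (G x \<bullet> i - K x \<bullet> i) * \<phi> x) = 0"
      using integrable_mult_bounded[OF sq(1) test_function_bounded_measurable[OF \<phi>]]
        integrable_mult_bounded[OF sq(2) test_function_bounded_measurable[OF \<phi>]]
      by (simp add: left_diff_distrib)
  qed
  then have "AE x in ?M. \<forall>i\<in>Basis. G x \<bullet> i - K x \<bullet> i = 0"
    by (simp add: AE_finite_all)
  then show ?thesis
  proof eventually_elim
    case (elim x)
    show ?case
      by (rule euclidean_eqI) (use elim in simp)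
  qed
qed

lemma has_weak_gradient_limit:
  assumes \<Omega>: "open \<Omega>" "bounded \<Omega>"
    and u: "\<And>k. u k \<in> L2 \<Omega>" "v \<in> L2 \<Omega>" "(\<lambda>k. sqdist (lebesgue_on \<Omega>) (u k) v) \<longlonglongrightarrow> 0"
    and G: "\<And>k. G k \<in> L2 \<Omega>" "K \<in> L2 \<Omega>" "(\<lambda>k. sqdist (lebesgue_on \<Omega>) (G k) K) \<longlonglongrightarrow> 0"
    and weak: "\<And>k. has_weak_gradient \<Omega> (u k) (G k)"
  shows "has_weak_gradient \<Omega> v K"
  unfolding has_weak_gradient_def
proof (intro ballI)
  fix \<phi> :: "'a \<Rightarrow> real" and i :: 'a assume \<phi>: "\<phi> \<in> test_functions \<Omega>" and i: "i \<in> Basis"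
  interpret finite_measure "lebesgue_on \<Omega>"
    by (rule finite_measure_lebesgue_on_bounded[OF \<Omega>])
  let ?M = "lebesgue_on \<Omega>" and ?d = "\<lambda>x. frechet_derivative \<phi> (at x) i"
  note sq = u(1,2) G(1,2)
  note sq = sq[unfolded L2_iff_square_integrable]
  obtain B where B: "\<And>x. \<bar>\<phi> x\<bar> \<le> B"
    using test_function_bounded_measurable(2)[OF \<phi>] by blast
  obtain B' where B': "\<And>x. \<bar>?d x\<bar> \<le> B'"
    using test_function_derivative_bounded_measurable(2)[OF \<phi> i] by blast
  have lim1: "(\<lambda>k. LINT x|?M. u k x * ?d x) \<longlonglongrightarrow> (LINT x|?M. v x * ?d x)"
    by (rule integral_mult_bounded_tendsto[OF sq(1,2) u(3)
          test_function_derivative_bounded_measurable(1)[OF \<phi> i] B'])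
  have "(\<lambda>k. sqdist ?M (\<lambda>x. G k x \<bullet> i) (\<lambda>x. K x \<bullet> i)) \<longlonglongrightarrow> 0"
    by (rule sqdist_contraction_tendsto[OF bounded_linear_inner_left _ sq(3,4) G(3)])
       (simp add: Basis_le_norm i)
  then have "(\<lambda>k. LINT x|?M. (G k x \<bullet> i) * \<phi> x) \<longlonglongrightarrow> (LINT x|?M. (K x \<bullet> i) * \<phi> x)"
    by (rule integral_mult_bounded_tendsto[OF square_integrable_inner[OF i sq(3)]
          square_integrable_inner[OF i sq(4)] _ test_function_bounded_measurable(1)[OF \<phi>] B])
  then have "(\<lambda>k. - (LINT x|?M. (G k x \<bullet> i) * \<phi> x)) \<longlonglongrightarrow> - (LINT x|?M. (K x \<bullet> i) * \<phi> x)"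
    by (rule tendsto_minus)
  moreover have "(LINT x|?M. u k x * ?d x) = - (LINT x|?M. (G k x \<bullet> i) * \<phi> x)" for k
    using weak \<phi> i by (simp add: has_weak_gradient_def)
  ultimately show "(LINT x|?M. v x * ?d x) = - (LINT x|?M. (K x \<bullet> i) * \<phi> x)"
    using lim1 LIMSEQ_unique by simp
qed

text \<open>The pair \<open>(u, \<nabla>u)\<close> embeds \<open>H\<^sup>1\<close> isometrically into a space of square integrable functions, up to
  equality almost everywhere; distances in \<open>H\<^sup>1\<close> are measured by \<open>sqdist\<close> of jets.\<close>

definition jet :: "'a::euclidean_space set \<Rightarrow> ('a \<Rightarrow> real) \<Rightarrow> 'a \<Rightarrow> real \<times> 'a" where
  "jet \<Omega> u = (\<lambda>x. (u x, wgrad \<Omega> u x))"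

lemma wgrad_is_weak_gradient:
  assumes "u \<in> H1 \<Omega>"
  shows "wgrad \<Omega> u \<in> L2 \<Omega>" "has_weak_gradient \<Omega> u (wgrad \<Omega> u)"
proof -
  have "\<exists>G. G \<in> L2 \<Omega> \<and> has_weak_gradient \<Omega> u G"
    using assms by (auto simp: H1_def)
  from someI_ex[OF this] show "wgrad \<Omega> u \<in> L2 \<Omega>" "has_weak_gradient \<Omega> u (wgrad \<Omega> u)"
    by (auto simp: wgrad_def)
qed

lemma jet_AE_eq:
  assumes "open \<Omega>" "bounded \<Omega>" "u \<in> L2 \<Omega>" "G \<in> L2 \<Omega>" "has_weak_gradient \<Omega> u G"
  shows "u \<in> H1 \<Omega>" "AE x in lebesgue_on \<Omega>. jet \<Omega> u x = (u x, G x)"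
proof -
  show u: "u \<in> H1 \<Omega>"
    using assms by (auto simp: H1_def)
  show "AE x in lebesgue_on \<Omega>. jet \<Omega> u x = (u x, G x)"
    using has_weak_gradient_unique[OF assms(1,2) wgrad_is_weak_gradient[OF u] assms(4,5)]
    by (simp add: jet_def)
qed

lemma norm_jet: "(norm (jet \<Omega> u x))\<^sup>2 = (norm (wgrad \<Omega> u x))\<^sup>2 + (u x)\<^sup>2"
  by (simp add: jet_def norm_Pair)

lemma jet_square_integrable:
  assumes "u \<in> H1 \<Omega>"
  shows "square_integrable (lebesgue_on \<Omega>) (jet \<Omega> u)"
proof -
  have *: "square_integrable (lebesgue_on \<Omega>) u" "square_integrable (lebesgue_on \<Omega>) (wgrad \<Omega> u)"
    using assms wgrad_is_weak_gradient(1)[OF assms] by (simp_all add: H1_def L2_iff_square_integrable)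
  then have "jet \<Omega> u \<in> borel_measurable (lebesgue_on \<Omega>)"
    unfolding jet_def by (intro borel_measurable_Pair square_integrable_measurable)
  then show ?thesis
    using * unfolding square_integrable_def norm_jet by simp
qed

lemma H1_norm_power2: "(H1_norm \<Omega> u)\<^sup>2 = (LINT x|lebesgue_on \<Omega>. (norm (jet \<Omega> u x))\<^sup>2)"
  by (simp add: H1_norm_def norm_jet)

text \<open>The jet contains an arbitrary choice of weak gradient, so linearity holds only almost everywhere and
  depends on the uniqueness of weak gradients.\<close>

lemma jet_linear:
  assumes \<Omega>: "open \<Omega>" "bounded \<Omega>" and u: "u \<in> H1 \<Omega>" and v: "v \<in> H1 \<Omega>"
  shows "(\<lambda>x. a * u x + b * v x) \<in> H1 \<Omega>"
    and "AE x in lebesgue_on \<Omega>. jet \<Omega> (\<lambda>x. a * u x + b * v x) x = a *\<^sub>R jet \<Omega> u x + b *\<^sub>R jet \<Omega> v x"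
proof -
  have L2: "u \<in> L2 \<Omega>" "v \<in> L2 \<Omega>"
    using u v by (auto simp: H1_def)
  have "(\<lambda>x. a * u x + b * v x) \<in> L2 \<Omega>"
    using L2 square_integrable_add[OF square_integrable_scaleR[of _ u a] square_integrable_scaleR[of _ v b]]
    by (simp add: L2_iff_square_integrable)
  moreover have "(\<lambda>x. a *\<^sub>R wgrad \<Omega> u x + b *\<^sub>R wgrad \<Omega> v x) \<in> L2 \<Omega>"
    using wgrad_is_weak_gradient(1)[OF u] wgrad_is_weak_gradient(1)[OF v]
    by (simp add: L2_iff_square_integrable square_integrable_add square_integrable_scaleR)
  ultimately show "(\<lambda>x. a * u x + b * v x) \<in> H1 \<Omega>"
    and "AE x in lebesgue_on \<Omega>. jet \<Omega> (\<lambda>x. a * u x + b * v x) x = a *\<^sub>R jet \<Omega> u x + b *\<^sub>R jet \<Omega> v x"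
    using jet_AE_eq[OF \<Omega> _ _ has_weak_gradient_linear[OF \<Omega> L2(1) wgrad_is_weak_gradient[OF u]
        L2(2) wgrad_is_weak_gradient[OF v], of a b]]
    by (simp_all add: jet_def)
qed

lemma closed_subspace_H1_linear:
  assumes "closed_subspace_H1 \<Omega> V" "u \<in> V" "v \<in> V"
  shows "(\<lambda>x. a * u x + b * v x) \<in> V"
proof -
  have scaled: "(\<lambda>x. a * u x) \<in> V" "(\<lambda>x. b * v x) \<in> V"
    using assms by (simp_all add: closed_subspace_H1_def)
  have add: "(\<lambda>x. u' x + v' x) \<in> V" if "u' \<in> V" "v' \<in> V" for u' v'
    using assms(1) that by (simp add: closed_subspace_H1_def)
  show ?thesis
    by (rule add[OF scaled])
qed

text \<open>The \<open>L\<^sup>2\<close> limit \<open>Q\<close> of the jets has components \<open>u\<close> and \<open>G\<close>, and \<open>G\<close> is a weak gradient of \<open>u\<close> because the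
  defining identity passes to the limit.\<close>

lemma closed_subspace_H1_complete:
  assumes \<Omega>: "open \<Omega>" "bounded \<Omega>" and V: "closed_subspace_H1 \<Omega> V"
    and s: "\<And>k::nat. s k \<in> V"
    and Cauchy: "\<And>e. e > 0 \<Longrightarrow> \<exists>N. \<forall>m\<ge>N. \<forall>n\<ge>N. sqdist (lebesgue_on \<Omega>) (jet \<Omega> (s m)) (jet \<Omega> (s n)) < e"
  shows "\<exists>u\<in>V. (\<lambda>k. sqdist (lebesgue_on \<Omega>) (jet \<Omega> (s k)) (jet \<Omega> u)) \<longlonglongrightarrow> 0"
proof -
  let ?M = "lebesgue_on \<Omega>"
  have H1: "s k \<in> H1 \<Omega>" for k
    using V s by (auto simp: closed_subspace_H1_def)
  note sq = jet_square_integrable[OF H1]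
  \<comment> \<open>the candidate limit, before it is known to be a jet\<close>
  obtain Q where Q: "square_integrable ?M Q" "(\<lambda>k. sqdist ?M (jet \<Omega> (s k)) Q) \<longlonglongrightarrow> 0"
    by (rule square_integrable_complete[OF sq Cauchy])
  define u where "u = (\<lambda>x. fst (Q x))"
  define G where "G = (\<lambda>x. snd (Q x))"
  note fst = bounded_linear_fst norm_fst_le[of "fst y" "snd y" for y, unfolded prod.collapse]
  note snd = bounded_linear_snd norm_snd_le[of "snd y" "fst y" for y, unfolded prod.collapse]
  have u: "u \<in> L2 \<Omega>" and G: "G \<in> L2 \<Omega>"
    using square_integrable_contraction[OF fst Q(1)] square_integrable_contraction[OF snd Q(1)]
    by (auto simp: u_def G_def L2_iff_square_integrable)
  have "(\<lambda>k. sqdist ?M (s k) u) \<longlonglongrightarrow> 0"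
    using sqdist_contraction_tendsto[OF fst sq Q] by (simp add: u_def jet_def)
  moreover have "(\<lambda>k. sqdist ?M (wgrad \<Omega> (s k)) G) \<longlonglongrightarrow> 0"
    using sqdist_contraction_tendsto[OF snd sq Q] by (simp add: G_def jet_def)
  moreover have "s k \<in> L2 \<Omega>" for k
    using H1[of k] by (simp add: H1_def)
  ultimately have "has_weak_gradient \<Omega> u G"
    by (intro has_weak_gradient_limit[OF \<Omega> _ u _ wgrad_is_weak_gradient(1)[OF H1] G _
          wgrad_is_weak_gradient(2)[OF H1]])
  from jet_AE_eq[OF \<Omega> u G this] have uH1: "u \<in> H1 \<Omega>" and "AE x in ?M. jet \<Omega> u x = (u x, G x)"
    by auto
  then have uQ: "AE x in ?M. jet \<Omega> u x = Q x"
    by (simp add: u_def G_def)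
  note squ = jet_square_integrable[OF uH1]
  have "sqdist ?M (jet \<Omega> (s k)) (jet \<Omega> u) = sqdist ?M (jet \<Omega> (s k)) Q" for k
    unfolding sqdist_def
    using sqdist_integrable[OF sq squ] sqdist_integrable[OF sq Q(1)] uQ
    by (intro integral_cong_AE) (auto simp: borel_measurable_integrable)
  then have lim: "(\<lambda>k. sqdist ?M (jet \<Omega> (s k)) (jet \<Omega> u)) \<longlonglongrightarrow> 0"
    using Q(2) by simp
  have "(H1_norm \<Omega> (\<lambda>x. s k x - u x))\<^sup>2 = sqdist ?M (jet \<Omega> (s k)) (jet \<Omega> u)" for k
  proof -
    note diff = jet_linear[OF \<Omega> H1[of k] uH1, of 1 "- 1", simplified]
    from jet_square_integrable[OF diff(1)] show ?thesis
      unfolding H1_norm_power2 sqdist_def using diff(2) sqdist_integrable[OF sq[of k] squ]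
      by (intro integral_cong_AE) (auto simp: square_integrable_def borel_measurable_integrable)
  qed
  then have "(\<lambda>k. sqrt ((H1_norm \<Omega> (\<lambda>x. s k x - u x))\<^sup>2)) \<longlonglongrightarrow> sqrt 0"
    using lim by (intro tendsto_real_sqrt) simp
  then have "(\<lambda>k. H1_norm \<Omega> (\<lambda>x. s k x - u x)) \<longlonglongrightarrow> 0"
    by (simp add: H1_norm_def)
  moreover have "u \<in> V" if "(\<lambda>k. H1_norm \<Omega> (\<lambda>x. s k x - u x)) \<longlonglongrightarrow> 0"
    using V[unfolded closed_subspace_H1_def] s uH1 that by metis
  ultimately have "u \<in> V" by blast
  then show ?thesis
    using lim by blast
qed

section \<open>Minimizers of convex combinations of two functionals\<close>

text \<open>The variational argument, separated from Sobolev spaces. The function \<open>d\<close> plays the role of a squared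
  distance on representatives: distinct points may be at distance \<open>0\<close>, as functions that agree almost
  everywhere are.\<close>

locale convex_pair =
  fixes V :: "'v set" and d :: "'v \<Rightarrow> 'v \<Rightarrow> real" and mid :: "'v \<Rightarrow> 'v \<Rightarrow> 'v"
    and \<Phi> H :: "'v \<Rightarrow> real" and c :: real
  assumes nonempty: "V \<noteq> {}"
    and mid_in: "u \<in> V \<Longrightarrow> v \<in> V \<Longrightarrow> mid u v \<in> V"
    and d_nonneg: "d u v \<ge> 0"
    and d_commute: "d u v = d v u"
    and complete: "(\<And>k::nat. s k \<in> V) \<Longrightarrow> (\<And>e. e > 0 \<Longrightarrow> \<exists>N. \<forall>m\<ge>N. \<forall>n\<ge>N. d (s m) (s n) < e)
      \<Longrightarrow> \<exists>u\<in>V. (\<lambda>k. d (s k) u) \<longlonglongrightarrow> 0"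
    and \<Phi>_tendsto: "(\<And>k::nat. s k \<in> V) \<Longrightarrow> u \<in> V \<Longrightarrow> (\<lambda>k. d (s k) u) \<longlonglongrightarrow> 0 \<Longrightarrow> (\<lambda>k. \<Phi> (s k)) \<longlonglongrightarrow> \<Phi> u"
    and H_tendsto: "(\<And>k::nat. s k \<in> V) \<Longrightarrow> u \<in> V \<Longrightarrow> (\<lambda>k. d (s k) u) \<longlonglongrightarrow> 0 \<Longrightarrow> (\<lambda>k. H (s k)) \<longlonglongrightarrow> H u"
    and c_pos: "c > 0"
    and \<Phi>_mid: "u \<in> V \<Longrightarrow> v \<in> V \<Longrightarrow> \<Phi> (mid u v) \<le> (\<Phi> u + \<Phi> v) / 2 - c * d u v"
    and H_mid: "u \<in> V \<Longrightarrow> v \<in> V \<Longrightarrow> H (mid u v) \<le> (H u + H v) / 2"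
    and bounded_below: "0 \<le> t \<Longrightarrow> t < 1 \<Longrightarrow> \<exists>B. \<forall>u\<in>V. B \<le> (1 - t) * \<Phi> u + t * H u"
begin

definition blend :: "real \<Rightarrow> 'v \<Rightarrow> real" where
  "blend t u = (1 - t) * \<Phi> u + t * H u"

lemma blend_mid:
  assumes "u \<in> V" "v \<in> V" "0 \<le> t" "t \<le> 1"
  shows "blend t (mid u v) \<le> (blend t u + blend t v) / 2 - (1 - t) * c * d u v"
proof -
  have "(1 - t) * \<Phi> (mid u v) \<le> (1 - t) * ((\<Phi> u + \<Phi> v) / 2 - c * d u v)"
    using assms \<Phi>_mid by (intro mult_left_mono) auto
  moreover have "t * H (mid u v) \<le> t * ((H u + H v) / 2)"
    using assms H_mid by (intro mult_left_mono) auto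
  ultimately show ?thesis
    by (simp add: blend_def algebra_simps add_divide_distrib diff_divide_distrib)
qed

lemma blend_tendsto:
  assumes "\<And>k::nat. s k \<in> V" "u \<in> V" "(\<lambda>k. d (s k) u) \<longlonglongrightarrow> 0" "t \<longlonglongrightarrow> t'"
  shows "(\<lambda>k. blend (t k) (s k)) \<longlonglongrightarrow> blend t' u"
  unfolding blend_def by (intro tendsto_intros assms \<Phi>_tendsto H_tendsto)

lemma minimizer_unique:
  assumes "0 \<le> t" "t < 1" "u \<in> global_minima (blend t) V" "v \<in> global_minima (blend t) V"
  shows "d u v = 0"
proof -
  have uv: "u \<in> V" "v \<in> V" "blend t u = blend t v" "blend t u \<le> blend t (mid u v)"
    using assms(3,4) mid_in by (auto simp: global_minima_def intro: antisym)
  then have "(1 - t) * c * d u v \<le> 0"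
    using blend_mid[of u v t] assms by auto
  moreover have "(1 - t) * c > 0"
    using assms c_pos by simp
  ultimately show ?thesis
    using d_nonneg[of u v] mult_pos_pos[of "(1 - t) * c" "d u v"] by linarith
qed

text \<open>By strong convexity at the midpoint, a minimizing sequence is Cauchy.\<close>

lemma minimizer_exists:
  assumes t: "0 \<le> t" "t < 1"
  shows "\<exists>u. u \<in> global_minima (blend t) V"
proof -
  define m where "m = Inf (blend t ` V)"
  obtain B where B: "\<And>u. u \<in> V \<Longrightarrow> B \<le> blend t u"
    using bounded_below[OF t] by (auto simp: blend_def)
  then have bdd: "bdd_below (blend t ` V)"
    by (auto simp: bdd_below_def)
  have m: "m \<le> blend t u" if "u \<in> V" for u
    unfolding m_def using bdd that by (intro cInf_lower) auto
  have "\<exists>u\<in>V. blend t u < m + inverse (real (Suc k))" for k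
    using cInf_lessD[of "blend t ` V" "m + inverse (real (Suc k))"] nonempty by (auto simp: m_def)
  then obtain s where s: "\<And>k. s k \<in> V" "\<And>k. blend t (s k) < m + inverse (real (Suc k))"
    by metis
  define C where "C = (1 - t) * c"
  have C: "C > 0"
    using t c_pos by (simp add: C_def)
  have "\<exists>u\<in>V. (\<lambda>k. d (s k) u) \<longlonglongrightarrow> 0"
  proof (rule complete[OF s(1)])
    fix e :: real assume e: "e > 0"
    obtain N where N: "inverse (real (Suc N)) < C * e"
      using reals_Archimedean[of "C * e"] C e by auto
    have "d (s i) (s j) < e" if "i \<ge> N" "j \<ge> N" for i j
    proof -
      have near: "blend t (s k) < m + C * e" if "k \<ge> N" for k
      proof -
        have "inverse (real (Suc k)) \<le> inverse (real (Suc N))"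
          using that by (auto intro!: le_imp_inverse_le)
        then have "m + inverse (real (Suc k)) < m + C * e"
          using N by (simp only: add_strict_left_mono order.strict_trans1)
        then show ?thesis
          using s(2)[of k] by (rule order.strict_trans[rotated])
      qed
      have "m \<le> (blend t (s i) + blend t (s j)) / 2 - C * d (s i) (s j)"
        using blend_mid[OF s(1) s(1), of t i j] m[OF mid_in[OF s(1) s(1)], of i j] t by (simp add: C_def)
      then have "C * d (s i) (s j) \<le> (blend t (s i) + blend t (s j)) / 2 - m"
        by linarith
      also have "\<dots> < C * e"
        using add_strict_mono[OF near[OF that(1)] near[OF that(2)]] by (simp add: field_simps)
      finally have "C * d (s i) (s j) < C * e" .
      then show ?thesis using C by simp
    qed
    then show "\<exists>N. \<forall>i\<ge>N. \<forall>j\<ge>N. d (s i) (s j) < e" by blast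
  qed
  then obtain u where u: "u \<in> V" "(\<lambda>k. d (s k) u) \<longlonglongrightarrow> 0" by blast
  have "(\<lambda>k. blend t (s k)) \<longlonglongrightarrow> blend t u"
    using blend_tendsto[OF s(1) u, of "\<lambda>_. t" t] by simp
  moreover have "(\<lambda>k. m + inverse (real (Suc k))) \<longlonglongrightarrow> m + 0"
    by (intro tendsto_intros LIMSEQ_inverse_real_of_nat)
  ultimately have "blend t u \<le> m"
    using LIMSEQ_le[of "\<lambda>k. blend t (s k)" "blend t u" "\<lambda>k. m + inverse (real (Suc k))" "m + 0"] s(2)
    by (auto intro: less_imp_le)
  then show ?thesis
    using u(1) m by (force simp: global_minima_def)
qed

text \<open>Comparing the two minimality conditions shows that \<open>H\<close> decreases from \<open>u\<close> to \<open>v\<close>. Hence \<open>H\<close> at the midpoint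
  is at most \<open>H u\<close>, and minimality of \<open>u\<close> against the midpoint leaves \<open>\<Phi> u \<le> \<Phi> (mid u v)\<close>; strong convexity
  of \<open>\<Phi>\<close> turns this into the distance bound.\<close>

lemma minimizers_ordered:
  assumes st: "0 \<le> s" "s < t" "t \<le> 1"
    and u: "u \<in> global_minima (blend s) V" and v: "v \<in> global_minima (blend t) V"
  shows "2 * c * d u v \<le> \<Phi> v - \<Phi> u"
proof -
  have V: "u \<in> V" "v \<in> V" "mid u v \<in> V"
    using u v mid_in by (auto simp: global_minima_def)
  have "blend s u \<le> blend s v" "blend t v \<le> blend t u"
    using u v by (auto simp: global_minima_def)
  then have 1: "0 \<le> (1 - s) * (\<Phi> v - \<Phi> u) + s * (H v - H u)"
    and 2: "(1 - t) * (\<Phi> v - \<Phi> u) + t * (H v - H u) \<le> 0"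
    by (auto simp: blend_def algebra_simps)
  have "(t - s) * (H v - H u) \<le> 0"
  proof -
    have "(1 - s) * ((1 - t) * (\<Phi> v - \<Phi> u) + t * (H v - H u)) \<le> 0"
      using st 2 by (simp add: mult_nonneg_nonpos)
    moreover have "0 \<le> (1 - t) * ((1 - s) * (\<Phi> v - \<Phi> u) + s * (H v - H u))"
      using st 1 by simp
    ultimately show ?thesis by (simp add: algebra_simps)
  qed
  then have "H v \<le> H u"
    using st by (simp add: mult_le_0_iff)
  then have "s * H (mid u v) \<le> s * H u"
    using H_mid[OF V(1,2)] st by (intro mult_left_mono) auto
  moreover have "blend s u \<le> blend s (mid u v)"
    using u V by (auto simp: global_minima_def)
  ultimately have "(1 - s) * \<Phi> u \<le> (1 - s) * \<Phi> (mid u v)"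
    by (simp add: blend_def)
  then have "\<Phi> u \<le> \<Phi> (mid u v)"
    using st by simp
  then show ?thesis
    using \<Phi>_mid[OF V(1,2)] by (simp add: field_simps)
qed

lemma minimizers_distance:
  assumes "0 \<le> s" "s < 1" "0 \<le> t" "t < 1"
    and u: "u \<in> global_minima (blend s) V" and v: "v \<in> global_minima (blend t) V"
  shows "2 * c * d u v \<le> \<bar>\<Phi> v - \<Phi> u\<bar>"
proof -
  consider "s < t" | "t < s" | "s = t" by linarith
  then show ?thesis
  proof cases
    case 1
    then show ?thesis using minimizers_ordered[of s t u v] assms by linarith
  next
    case 2
    then show ?thesis using minimizers_ordered[of t s v u] assms unfolding d_commute[of u v] by linarith
  next
    case 3
    then show ?thesis using minimizer_unique[of s u v] assms by simp
  qed
qed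

text \<open>A subsequence with convergent \<open>\<Phi>\<close>-values is Cauchy by the distance bound. The parameter \<open>t' = 1\<close> is
  allowed in the limit, although strong convexity fails there.\<close>

lemma minimizers_limit:
  assumes t: "\<And>k::nat. 0 \<le> t k" "\<And>k. t k < 1" "t \<longlonglongrightarrow> t'"
    and U: "\<And>k. U k \<in> global_minima (blend (t k)) V"
    and bounds: "\<And>k. lo \<le> \<Phi> (U k)" "\<And>k. \<Phi> (U k) \<le> hi"
  shows "\<exists>w\<in>global_minima (blend t') V. lo \<le> \<Phi> w \<and> \<Phi> w \<le> hi"
proof -
  have UV: "U k \<in> V" for k
    using U by (auto simp: global_minima_def)
  have "bounded (range (\<lambda>k. \<Phi> (U k)))"
    using bounds by (intro bounded_subset[OF bounded_closed_interval[of lo hi]]) auto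
  then obtain l r where r: "strict_mono r" "(\<lambda>k. \<Phi> (U (r k))) \<longlonglongrightarrow> l"
    using bounded_imp_convergent_subsequence[of "\<lambda>k. \<Phi> (U k)"] by (auto simp: o_def)
  have "\<exists>w\<in>V. (\<lambda>k. d (U (r k)) w) \<longlonglongrightarrow> 0"
  proof (rule complete[OF UV])
    fix e :: real assume e: "e > 0"
    have "Cauchy (\<lambda>k. \<Phi> (U (r k)))"
      using r(2) by (rule LIMSEQ_imp_Cauchy)
    then obtain N where N: "\<And>i j. i \<ge> N \<Longrightarrow> j \<ge> N \<Longrightarrow> \<bar>\<Phi> (U (r i)) - \<Phi> (U (r j))\<bar> < 2 * c * e"
      using metric_CauchyD[of "\<lambda>k. \<Phi> (U (r k))" "2 * c * e"] c_pos e by (auto simp: dist_real_def)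
    have "d (U (r i)) (U (r j)) < e" if "i \<ge> N" "j \<ge> N" for i j
    proof -
      have "2 * c * d (U (r i)) (U (r j)) < 2 * c * e"
        using minimizers_distance[OF t(1,2) t(1,2) U U, of "r i" "r j"] N[OF that(2,1)] by linarith
      then show ?thesis using c_pos by simp
    qed
    then show "\<exists>N. \<forall>i\<ge>N. \<forall>j\<ge>N. d (U (r i)) (U (r j)) < e" by blast
  qed
  then obtain w where w: "w \<in> V" "(\<lambda>k. d (U (r k)) w) \<longlonglongrightarrow> 0" by blast
  have tr: "(\<lambda>k. t (r k)) \<longlonglongrightarrow> t'"
    using LIMSEQ_subseq_LIMSEQ[OF t(3) r(1)] by (simp add: o_def)
  have "blend t' w \<le> blend t' v" if v: "v \<in> V" for v
  proof (rule LIMSEQ_le)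
    show "(\<lambda>k. blend (t (r k)) (U (r k))) \<longlonglongrightarrow> blend t' w"
      by (rule blend_tendsto[OF UV w tr])
    show "(\<lambda>k. blend (t (r k)) v) \<longlonglongrightarrow> blend t' v"
      unfolding blend_def by (intro tendsto_intros tr)
    show "\<exists>N. \<forall>k\<ge>N. blend (t (r k)) (U (r k)) \<le> blend (t (r k)) v"
      using U v by (auto simp: global_minima_def)
  qed
  then have "w \<in> global_minima (blend t') V"
    using w(1) by (simp add: global_minima_def)
  moreover have "(\<lambda>k. \<Phi> (U (r k))) \<longlonglongrightarrow> \<Phi> w"
    by (rule \<Phi>_tendsto[OF UV w])
  then have "lo \<le> \<Phi> w" "\<Phi> w \<le> hi"
    using bounds by (auto intro: LIMSEQ_le_const LIMSEQ_le_const2)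
  ultimately show ?thesis by blast
qed

lemma minimizers_same_\<Phi>:
  assumes "0 \<le> t" "t < 1" "u \<in> global_minima (blend t) V" "v \<in> global_minima (blend t) V"
  shows "\<Phi> u = \<Phi> v"
proof -
  have "u \<in> V" "v \<in> V" "d u v = 0"
    using assms minimizer_unique by (auto simp: global_minima_def)
  then have "(\<lambda>k::nat. \<Phi> u) \<longlonglongrightarrow> \<Phi> v"
    using \<Phi>_tendsto[of "\<lambda>_. u" v] by simp
  then show ?thesis
    by (simp add: LIMSEQ_const_iff)
qed

text \<open>Approaching the supremum \<open>t'\<close> of the parameters with \<open>\<Phi> \<le> r\<close> from below gives a minimizer with \<open>\<Phi> \<le> r\<close>, and
  from above one with \<open>\<Phi> \<ge> r\<close>. If \<open>t' < 1\<close>, minimizers are unique as far as \<open>\<Phi>\<close> can tell, so both have \<open>\<Phi> = r\<close>.\<close>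

theorem minimizer_on_level:
  assumes u0: "u0 \<in> global_minima \<Phi> V" "\<Phi> u0 \<le> r"
    and above: "\<And>u. u \<in> global_minima H V \<Longrightarrow> r < \<Phi> u"
  obtains t u where "0 \<le> t" "t < 1" "u \<in> global_minima (blend t) V" "\<Phi> u = r"
proof -
  have F0: "blend 0 = \<Phi>" and F1: "blend 1 = H"
    by (auto simp: blend_def)
  have "\<forall>t. \<exists>u. 0 \<le> t \<and> t < 1 \<longrightarrow> u \<in> global_minima (blend t) V"
    using minimizer_exists by blast
  then obtain U where U: "\<And>t. 0 \<le> t \<Longrightarrow> t < 1 \<Longrightarrow> U t \<in> global_minima (blend t) V"
    by metis
  have lower: "\<Phi> u0 \<le> \<Phi> (U t)" if "0 \<le> t" "t < 1" for t
    using U[OF that] u0 by (auto simp: global_minima_def)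
  define A where "A = {t. 0 \<le> t \<and> t < 1 \<and> \<Phi> (U t) \<le> r}"
  have "\<Phi> (U 0) = \<Phi> u0"
    using minimizers_same_\<Phi>[of 0 "U 0" u0] U[of 0] u0 F0 by simp
  then have "0 \<in> A"
    using u0 by (simp add: A_def)
  have bdd: "bdd_above A"
    by (auto simp: A_def bdd_above_def intro!: exI[of _ 1])
  define t' where "t' = Sup A"
  have t': "0 \<le> t'" "t' \<le> 1"
    unfolding t'_def using \<open>0 \<in> A\<close> bdd
    by (rule cSup_upper) (use \<open>0 \<in> A\<close> in \<open>auto simp: A_def intro!: cSup_least\<close>)
  obtain a where a: "\<And>k::nat. a k \<in> A" "a \<longlonglongrightarrow> t'"
    using closure_contains_Sup[of A] \<open>0 \<in> A\<close> bdd
    unfolding closure_sequential t'_def by blast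
  have "\<exists>w\<in>global_minima (blend t') V. \<Phi> u0 \<le> \<Phi> w \<and> \<Phi> w \<le> r"
    using a lower U by (intro minimizers_limit[where t = a and U = "\<lambda>k. U (a k)"]) (auto simp: A_def)
  then obtain w where w: "w \<in> global_minima (blend t') V" "\<Phi> w \<le> r" by blast
  \<comment> \<open>for \<open>t' = 1\<close>, \<open>w\<close> would be a minimizer of \<open>H\<close> with \<open>\<Phi> w \<le> r\<close>\<close>
  have t'1: "t' < 1"
    using w above F1 t' by (cases "t' = 1") (auto simp: not_le[symmetric])
  \<comment> \<open>parameters in \<open>]t', 1[\<close> decreasing to \<open>t'\<close>, on which \<open>\<Phi>\<close> exceeds \<open>r\<close> by the choice of \<open>t'\<close>\<close>
  define b where "b = (\<lambda>k::nat. t' + (1 - t') / 2 * inverse (real (Suc k)))"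
  have b: "t' < b k" "b k \<le> b 0" "b k < 1" for k
  proof -
    have inv: "0 < inverse (real (Suc k))" "inverse (real (Suc k)) \<le> 1"
      by (auto simp: field_simps)
    then show "t' < b k"
      using t'1 by (simp add: b_def)
    have "(1 - t') / 2 * inverse (real (Suc k)) \<le> (1 - t') / 2 * 1"
      using t'1 inv by (intro mult_left_mono) auto
    then have b_le: "b k \<le> t' + (1 - t') / 2"
      by (simp add: b_def)
    show "b k \<le> b 0"
      using b_le by (simp add: b_def)
    have "t' + (1 - t') / 2 < 1"
      using t'1 by (simp add: field_simps)
    with b_le show "b k < 1"
      by (rule order.strict_trans1)
  qed
  have b01: "0 \<le> b k" for k
    using b(1)[of k] t' by linarith
  have bA: "r < \<Phi> (U (b k))" for k
  proof (rule ccontr)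
    assume "\<not> ?thesis"
    then have "b k \<in> A"
      using b b01 by (simp add: A_def)
    then have "b k \<le> t'"
      unfolding t'_def using bdd by (rule cSup_upper)
    then show False
      using b(1)[of k] by simp
  qed
  have b_upper: "\<Phi> (U (b k)) \<le> \<Phi> (U (b 0))" for k
  proof (cases "b k = b 0")
    case False
    then have "2 * c * d (U (b k)) (U (b 0)) \<le> \<Phi> (U (b 0)) - \<Phi> (U (b k))"
      using b[of k] b(3)[of 0] b01 U by (intro minimizers_ordered[of "b k" "b 0"]) auto
    then show ?thesis
      using c_pos d_nonneg[of "U (b k)" "U (b 0)"] by (smt (verit) mult_nonneg_nonneg)
  qed simp
  have "(\<lambda>k. t' + (1 - t') / 2 * inverse (real (Suc k))) \<longlonglongrightarrow> t' + (1 - t') / 2 * 0"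
    by (intro tendsto_intros LIMSEQ_inverse_real_of_nat)
  then have "b \<longlonglongrightarrow> t'"
    by (simp add: b_def)
  then have "\<exists>w\<in>global_minima (blend t') V. r \<le> \<Phi> w \<and> \<Phi> w \<le> \<Phi> (U (b 0))"
    using b(3) b01 U bA b_upper
    by (intro minimizers_limit[where t = b and U = "\<lambda>k. U (b k)"]) (auto intro: less_imp_le)
  then obtain w' where "w' \<in> global_minima (blend t') V" "r \<le> \<Phi> w'" by blast
  then have "\<Phi> w = r"
    using minimizers_same_\<Phi>[OF t'(1) t'1 w(1)] w(2) by force
  then show ?thesis
    using that t'(1) t'1 w(1) by blast
qed

end

section \<open>Integral functionals on H1\<close>

lemma integral_functional_jet: "integral_functional \<Omega> h u = (LINT x|lebesgue_on \<Omega>. h (jet \<Omega> u x))"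
  by (simp add: integral_functional_def jet_def)

context
  fixes \<Omega> :: "'a::euclidean_space set"
  assumes \<Omega>: "open \<Omega>" "bounded \<Omega>"
begin

interpretation finite_measure "lebesgue_on \<Omega>"
  by (rule finite_measure_lebesgue_on_bounded[OF \<Omega>])

abbreviation (input) "jdist u v \<equiv> sqdist (lebesgue_on \<Omega>) (jet \<Omega> u) (jet \<Omega> v)"

lemma integral_functional_AE_eq:
  assumes h: "continuous_on UNIV h" and u: "u \<in> H1 \<Omega>"
    and Q: "square_integrable (lebesgue_on \<Omega>) Q" "AE x in lebesgue_on \<Omega>. jet \<Omega> u x = Q x"
  shows "integral_functional \<Omega> h u = (LINT x|lebesgue_on \<Omega>. h (Q x))"
  unfolding integral_functional_jet
proof (rule integral_cong_AE)
  show "(\<lambda>x. h (jet \<Omega> u x)) \<in> borel_measurable (lebesgue_on \<Omega>)"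
    by (rule borel_measurable_continuous_on[OF h square_integrable_measurable[OF jet_square_integrable[OF u]]])
  show "(\<lambda>x. h (Q x)) \<in> borel_measurable (lebesgue_on \<Omega>)"
    by (rule borel_measurable_continuous_on[OF h square_integrable_measurable[OF Q(1)]])
  show "AE x in lebesgue_on \<Omega>. h (jet \<Omega> u x) = h (Q x)"
    using Q(2) by eventually_elim simp
qed

lemma integral_functional_midpoint:
  assumes h: "is_gradient h Dh" "l-lipschitz_on UNIV Dh" and u: "u \<in> H1 \<Omega>" and v: "v \<in> H1 \<Omega>"
  shows "\<bar>integral_functional \<Omega> h u + integral_functional \<Omega> h v
            - 2 * integral_functional \<Omega> h (\<lambda>x. 1 / 2 * u x + 1 / 2 * v x)\<bar> \<le> l / 4 * jdist u v"
proof -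
  let ?M = "lebesgue_on \<Omega>" and ?m = "\<lambda>x. (1 / 2) *\<^sub>R (jet \<Omega> u x + jet \<Omega> v x)"
  note sq = jet_square_integrable[OF u] jet_square_integrable[OF v]
  have sqm: "square_integrable ?M ?m"
    by (intro square_integrable_scaleR square_integrable_add sq)
  note int = integrable_lipschitz_gradient[OF h]
  have "integral_functional \<Omega> h (\<lambda>x. 1 / 2 * u x + 1 / 2 * v x) = (LINT x|?M. h (?m x))"
    using jet_linear[OF \<Omega> u v, of "1/2" "1/2"]
    by (intro integral_functional_AE_eq[OF is_gradient_imp_continuous_on[OF h(1)] _ sqm])
       (simp_all add: scaleR_add_right)
  then have "integral_functional \<Omega> h u + integral_functional \<Omega> h v
            - 2 * integral_functional \<Omega> h (\<lambda>x. 1 / 2 * u x + 1 / 2 * v x)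
          = (LINT x|?M. h (jet \<Omega> u x) + h (jet \<Omega> v x) - 2 * h (?m x))"
    by (simp add: integral_functional_jet int[OF sq(1)] int[OF sq(2)] int[OF sqm])
  also have "\<bar>\<dots>\<bar> \<le> (LINT x|?M. \<bar>h (jet \<Omega> u x) + h (jet \<Omega> v x) - 2 * h (?m x)\<bar>)"
    by (rule integral_abs_bound)
  also have "\<dots> \<le> (LINT x|?M. l / 4 * (norm (jet \<Omega> u x - jet \<Omega> v x))\<^sup>2)"
  proof (rule integral_mono)
    show "integrable ?M (\<lambda>x. \<bar>h (jet \<Omega> u x) + h (jet \<Omega> v x) - 2 * h (?m x)\<bar>)"
      by (intro integrable_abs Bochner_Integration.integrable_diff Bochner_Integration.integrable_add
          integrable_mult_right int sq sqm)
    show "integrable ?M (\<lambda>x. l / 4 * (norm (jet \<Omega> u x - jet \<Omega> v x))\<^sup>2)"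
      by (intro integrable_mult_right sqdist_integrable[OF sq])
    show "\<bar>h (jet \<Omega> u x) + h (jet \<Omega> v x) - 2 * h (?m x)\<bar> \<le> l / 4 * (norm (jet \<Omega> u x - jet \<Omega> v x))\<^sup>2" for x
      by (rule gradient_lipschitz_midpoint[OF h])
  qed
  also have "\<dots> = l / 4 * jdist u v"
    by (simp add: sqdist_def)
  finally show ?thesis .
qed

lemma H1_norm_midpoint:
  assumes u: "u \<in> H1 \<Omega>" and v: "v \<in> H1 \<Omega>"
  shows "(H1_norm \<Omega> u)\<^sup>2 + (H1_norm \<Omega> v)\<^sup>2 - 2 * (H1_norm \<Omega> (\<lambda>x. 1 / 2 * u x + 1 / 2 * v x))\<^sup>2
           = 1 / 2 * jdist u v"
proof -
  let ?M = "lebesgue_on \<Omega>" and ?m = "\<lambda>x. (1 / 2) *\<^sub>R (jet \<Omega> u x + jet \<Omega> v x)"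
  note sq = jet_square_integrable[OF u] jet_square_integrable[OF v]
  have sqm: "square_integrable ?M ?m"
    by (intro square_integrable_scaleR square_integrable_add sq)
  have "(H1_norm \<Omega> (\<lambda>x. 1 / 2 * u x + 1 / 2 * v x))\<^sup>2
          = integral_functional \<Omega> (\<lambda>p. (norm p)\<^sup>2) (\<lambda>x. 1 / 2 * u x + 1 / 2 * v x)"
    by (simp add: H1_norm_power2 integral_functional_jet)
  also have "\<dots> = (LINT x|?M. (norm (?m x))\<^sup>2)"
    using jet_linear[OF \<Omega> u v, of "1/2" "1/2"]
    by (intro integral_functional_AE_eq[OF _ _ sqm])
       (simp_all add: scaleR_add_right continuous_intros)
  finally have "(H1_norm \<Omega> u)\<^sup>2 + (H1_norm \<Omega> v)\<^sup>2 - 2 * (H1_norm \<Omega> (\<lambda>x. 1 / 2 * u x + 1 / 2 * v x))\<^sup>2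
      = (LINT x|?M. (norm (jet \<Omega> u x))\<^sup>2 + (norm (jet \<Omega> v x))\<^sup>2 - 2 * (norm (?m x))\<^sup>2)"
    using sq sqm by (simp only: H1_norm_power2 square_integrable_def Bochner_Integration.integral_add
      Bochner_Integration.integral_diff Bochner_Integration.integrable_add integral_mult_right_zero integrable_mult_right)
  also have "\<dots> = (LINT x|?M. 1 / 2 * (norm (jet \<Omega> u x - jet \<Omega> v x))\<^sup>2)"
  proof (rule Bochner_Integration.integral_cong[OF refl])
    have "(norm p)\<^sup>2 + (norm q)\<^sup>2 - 2 * (norm ((1 / 2) *\<^sub>R (p + q)))\<^sup>2 = 1 / 2 * (norm (p - q))\<^sup>2"
      for p q :: "real \<times> 'a"
      by (simp add: power2_norm_eq_inner inner_add_left inner_add_right inner_diff_left inner_diff_right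
          inner_commute[of q p] field_simps)
    then show "(norm (jet \<Omega> u x))\<^sup>2 + (norm (jet \<Omega> v x))\<^sup>2 - 2 * (norm (?m x))\<^sup>2
        = 1 / 2 * (norm (jet \<Omega> u x - jet \<Omega> v x))\<^sup>2" for x .
  qed
  also have "\<dots> = 1 / 2 * jdist u v"
    by (simp add: sqdist_def)
  finally show ?thesis .
qed

lemma integral_functional_tendsto:
  assumes h: "is_gradient h Dh" "l-lipschitz_on UNIV Dh"
    and s: "\<And>k. s k \<in> H1 \<Omega>" and u: "u \<in> H1 \<Omega>" and lim: "(\<lambda>k. jdist (s k) u) \<longlonglongrightarrow> 0"
  shows "(\<lambda>k. integral_functional \<Omega> h (s k)) \<longlonglongrightarrow> integral_functional \<Omega> h u"
  unfolding integral_functional_jet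
  by (rule lipschitz_gradient_functional_tendsto[OF h jet_square_integrable[OF s] jet_square_integrable[OF u] lim])

lemma H1_norm_power2_tendsto:
  assumes "\<And>k. s k \<in> H1 \<Omega>" "u \<in> H1 \<Omega>" "(\<lambda>k. jdist (s k) u) \<longlonglongrightarrow> 0"
  shows "(\<lambda>k. (H1_norm \<Omega> (s k))\<^sup>2) \<longlonglongrightarrow> (H1_norm \<Omega> u)\<^sup>2"
  using integral_functional_tendsto[OF is_gradient_norm_power2 lipschitz_norm_power2_gradient assms]
  by (simp add: H1_norm_power2 integral_functional_jet)

text \<open>First-order expansion at \<open>0\<close> along a line. It provides the directional derivative of the functional
  at \<open>0\<close> in the form needed to exclude \<open>0\<close> from the minimizers of \<open>H\<close>.\<close>

lemma integral_functional_expansion: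
  assumes h: "is_gradient h Dh" "l-lipschitz_on UNIV Dh" and v: "v \<in> H1 \<Omega>"
  shows "\<bar>integral_functional \<Omega> h (\<lambda>x. t * v x) - h 0 * measure (lebesgue_on \<Omega>) \<Omega>
           - t * (LINT x|lebesgue_on \<Omega>. Dh 0 \<bullet> jet \<Omega> v x)\<bar> \<le> l / 2 * t\<^sup>2 * (H1_norm \<Omega> v)\<^sup>2"
proof -
  let ?M = "lebesgue_on \<Omega>"
  note sq = jet_square_integrable[OF v]
  note sqt = square_integrable_scaleR[OF sq, of t]
  note int = integrable_lipschitz_gradient[OF h sqt]
  have int_inner: "integrable ?M (\<lambda>x. Dh 0 \<bullet> jet \<Omega> v x)"
  proof (rule Bochner_Integration.integrable_bound)
    show "integrable ?M (\<lambda>x. norm (Dh 0) * norm (jet \<Omega> v x))"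
      by (intro integrable_mult_right square_integrable_imp_norm_integrable sq)
    show "(\<lambda>x. Dh 0 \<bullet> jet \<Omega> v x) \<in> borel_measurable ?M"
      using square_integrable_measurable[OF sq] by simp
    show "AE x in ?M. norm (Dh 0 \<bullet> jet \<Omega> v x) \<le> norm (norm (Dh 0) * norm (jet \<Omega> v x))"
      using Cauchy_Schwarz_ineq2[of "Dh 0"] by simp
  qed
  have int_sq: "integrable ?M (\<lambda>x. (norm (jet \<Omega> v x))\<^sup>2)"
    using sq by (simp add: square_integrable_def)
  have "integral_functional \<Omega> h (\<lambda>x. t * v x) = (LINT x|?M. h (t *\<^sub>R jet \<Omega> v x))"
    using jet_linear[OF \<Omega> v v, of t 0]
    by (intro integral_functional_AE_eq[OF is_gradient_imp_continuous_on[OF h(1)] _ sqt]) simp_all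
  then have "integral_functional \<Omega> h (\<lambda>x. t * v x) - h 0 * measure ?M \<Omega> - t * (LINT x|?M. Dh 0 \<bullet> jet \<Omega> v x)
      = (LINT x|?M. h (t *\<^sub>R jet \<Omega> v x) - h 0 - t * (Dh 0 \<bullet> jet \<Omega> v x))"
    by (simp add: int int_inner mult.commute)
  also have "\<bar>\<dots>\<bar> \<le> (LINT x|?M. \<bar>h (t *\<^sub>R jet \<Omega> v x) - h 0 - t * (Dh 0 \<bullet> jet \<Omega> v x)\<bar>)"
    by (rule integral_abs_bound)
  also have "\<dots> \<le> (LINT x|?M. l / 2 * t\<^sup>2 * (norm (jet \<Omega> v x))\<^sup>2)"
  proof (rule integral_mono)
    show "integrable ?M (\<lambda>x. \<bar>h (t *\<^sub>R jet \<Omega> v x) - h 0 - t * (Dh 0 \<bullet> jet \<Omega> v x)\<bar>)"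
      by (intro integrable_abs Bochner_Integration.integrable_diff integrable_mult_right int int_inner integrable_const)
    show "integrable ?M (\<lambda>x. l / 2 * t\<^sup>2 * (norm (jet \<Omega> v x))\<^sup>2)"
      by (intro integrable_mult_right int_sq)
    show "\<bar>h (t *\<^sub>R jet \<Omega> v x) - h 0 - t * (Dh 0 \<bullet> jet \<Omega> v x)\<bar> \<le> l / 2 * t\<^sup>2 * (norm (jet \<Omega> v x))\<^sup>2" for x
      using gradient_lipschitz_bound[OF h, of "t *\<^sub>R jet \<Omega> v x" 0] by (simp add: power_mult_distrib)
  qed
  also have "\<dots> = l / 2 * t\<^sup>2 * (H1_norm \<Omega> v)\<^sup>2"
    by (simp add: H1_norm_power2)
  finally show ?thesis .
qed

text \<open>The integrand is at least \<open>(1 - lam L / 2) |p|\<^sup>2\<close> minus a linear function of \<open>|p|\<close>, hence bounded below,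
  and \<open>\<Omega>\<close> has finite measure.\<close>

lemma penalized_functional_bounded_below:
  assumes f: "is_gradient f Df" "L-lipschitz_on UNIV Df" and lam: "0 \<le> lam" "lam * L < 2"
  shows "\<exists>B. \<forall>u\<in>H1 \<Omega>. B \<le> (H1_norm \<Omega> u)\<^sup>2 + lam * integral_functional \<Omega> f u"
proof -
  define a where "a = 1 - lam * L / 2"
  define B where "B = lam * f 0 - 1 / a * (lam * norm (Df 0))\<^sup>2"
  have a: "a > 0"
    using lam by (simp add: a_def)
  have pointwise: "B \<le> (norm p)\<^sup>2 + lam * f p" for p
  proof -
    have "f 0 - norm (Df 0) * norm p - L / 2 * (norm p)\<^sup>2 \<le> f p"
      using gradient_lipschitz_bound[OF f, of p 0] Cauchy_Schwarz_ineq2[of "Df 0" p]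
      unfolding diff_0_right by linarith
    then have "lam * (f 0 - norm (Df 0) * norm p - L / 2 * (norm p)\<^sup>2) \<le> lam * f p"
      using lam by (intro mult_left_mono)
    moreover have "norm p * (lam * norm (Df 0)) \<le> a * (norm p)\<^sup>2 + 1 / a * (lam * norm (Df 0))\<^sup>2"
      by (rule Young_eps[OF a])
    ultimately show ?thesis
      by (simp add: B_def a_def algebra_simps)
  qed
  have "B * measure (lebesgue_on \<Omega>) \<Omega> \<le> (H1_norm \<Omega> u)\<^sup>2 + lam * integral_functional \<Omega> f u"
    if u: "u \<in> H1 \<Omega>" for u
  proof -
    note sq = jet_square_integrable[OF u]
    have int: "integrable (lebesgue_on \<Omega>) (\<lambda>x. (norm (jet \<Omega> u x))\<^sup>2)"
      "integrable (lebesgue_on \<Omega>) (\<lambda>x. lam * f (jet \<Omega> u x))"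
      using sq integrable_lipschitz_gradient[OF f sq] by (simp_all add: square_integrable_def)
    have "B * measure (lebesgue_on \<Omega>) \<Omega> = (LINT x|lebesgue_on \<Omega>. B)"
      by simp
    also have "\<dots> \<le> (LINT x|lebesgue_on \<Omega>. (norm (jet \<Omega> u x))\<^sup>2 + lam * f (jet \<Omega> u x))"
      by (intro integral_mono integrable_const Bochner_Integration.integrable_add int pointwise)
    also have "\<dots> = (H1_norm \<Omega> u)\<^sup>2 + lam * integral_functional \<Omega> f u"
      using int by (simp add: H1_norm_power2 integral_functional_jet)
    finally show ?thesis .
  qed
  then show ?thesis by blast
qed

end

section \<open>Minima on the level sets\<close>

lemma quadratic_nonneg_imp_linear_coeff_0:
  fixes a C :: real
  assumes nonneg: "\<And>t. 0 \<le> a * t + C * t\<^sup>2" and "C \<ge> 0"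
  shows "a = 0"
proof -
  \<comment> \<open>the inequality is tested at \<open>t = - a s\<close>; the summand \<open>1\<close> covers \<open>C = 0\<close>\<close>
  define s where "s = 1 / (C + 1)"
  have s: "s > 0" "C * s < 1"
    using assms(2) by (auto simp: s_def)
  have "0 \<le> a\<^sup>2 * (s * (C * s - 1))"
    using nonneg[of "- a * s"] by (simp add: power2_eq_square algebra_simps)
  moreover have "s * (C * s - 1) < 0"
    using s by (simp add: mult_pos_neg)
  ultimately have "a\<^sup>2 \<le> 0"
    using mult_pos_neg[of "a\<^sup>2" "s * (C * s - 1)"] by linarith
  then show ?thesis by simp
qed

theorem theorem1:
  fixes \<Omega> :: "'a::euclidean_space set"
    and f g :: "real \<times> 'a \<Rightarrow> real"
    and Df Dg :: "real \<times> 'a \<Rightarrow> real \<times> 'a"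
    and L \<nu> :: real
    and V :: "('a \<Rightarrow> real) set"
  defines "J \<equiv> integral_functional \<Omega> f"
    and "\<Phi> \<equiv> (\<lambda>u. (H1_norm \<Omega> u)\<^sup>2 + integral_functional \<Omega> g u)"
  defines "S \<equiv> global_minima (\<lambda>u. \<Phi> u + (2 - \<nu>) / L * J u) V"
  defines "\<delta> \<equiv> (INF u\<in>S. ereal (\<Phi> u))"
  assumes "open \<Omega>" "connected \<Omega>" "\<Omega> \<noteq> {}" "bounded \<Omega>"
    and "is_gradient f Df" "continuous_on UNIV Df" "\<not> Df constant_on UNIV"
    and "least_lipschitz_constant Df L"
    and "\<And>p. g p \<ge> 0" "g 0 = 0"
    and "is_gradient g Dg" "continuous_on UNIV Dg"
    and "\<nu>-lipschitz_on UNIV Dg" "\<nu> < 2"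
    and "closed_subspace_H1 \<Omega> V"
    and "\<exists>v\<^sub>0\<in>V. (LINT x|lebesgue_on \<Omega>. fst (Df 0) * v\<^sub>0 x + snd (Df 0) \<bullet> wgrad \<Omega> v\<^sub>0 x) \<noteq> 0"
  shows "\<delta> > 0 \<and>
    (\<forall>r::real. 0 < r \<and> ereal r < \<delta> \<longrightarrow>
      (\<exists>u\<in>global_minima J {u \<in> V. \<Phi> u = r}.
        \<forall>w\<in>global_minima J {u \<in> V. \<Phi> u = r}. AE x in lebesgue_on \<Omega>. w x = u x))"
proof -
  note \<Omega> = \<open>open \<Omega>\<close> \<open>bounded \<Omega>\<close>
  have f: "is_gradient f Df" "L-lipschitz_on UNIV Df"
    using assms by (simp_all add: least_lipschitz_constant_def)
  have g: "is_gradient g Dg" "\<nu>-lipschitz_on UNIV Dg"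
    using assms by simp_all
  note V = \<open>closed_subspace_H1 \<Omega> V\<close>
  have VH1: "u \<in> H1 \<Omega>" if "u \<in> V" for u
    using V that by (auto simp: closed_subspace_H1_def)
  obtain v0 where v0: "v0 \<in> V"
    "(LINT x|lebesgue_on \<Omega>. fst (Df 0) * v0 x + snd (Df 0) \<bullet> wgrad \<Omega> v0 x) \<noteq> 0"
    using assms by blast
  have \<nu>: "0 \<le> \<nu>" "\<nu> < 2"
    using lipschitz_on_nonneg[OF g(2)] \<open>\<nu> < 2\<close> by simp_all
  have L: "L > 0"
  proof (rule ccontr)
    assume "\<not> L > 0"
    then have "L = 0"
      using lipschitz_on_nonneg[OF f(2)] by simp
    then have "Df p = Df 0" for p
      using lipschitz_onD[OF f(2), of p 0] by simp
    then show False
      using \<open>\<not> Df constant_on UNIV\<close> unfolding constant_on_def by blast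
  qed
  define c where "c = (2 - \<nu>) / L"
  have c: "c > 0" "c * L = 2 - \<nu>"
    using L \<nu> by (simp_all add: c_def)
  define H where "H = (\<lambda>u. \<Phi> u + c * J u)"
  have S: "S = global_minima H V"
    by (simp add: S_def H_def c_def)
  define d where "d = (\<lambda>u v. sqdist (lebesgue_on \<Omega>) (jet \<Omega> u) (jet \<Omega> v))"
  define mid where "mid = (\<lambda>(u::'a \<Rightarrow> real) v x. 1 / 2 * u x + 1 / 2 * v x)"
  have mid_in: "mid u v \<in> V" if "u \<in> V" "v \<in> V" for u v
    unfolding mid_def by (rule closed_subspace_H1_linear[OF V that])
  have g_nonneg: "0 \<le> integral_functional \<Omega> g u" for u
    using assms by (simp add: integral_functional_def)
  have \<Phi>_mid: "\<Phi> (mid u v) \<le> (\<Phi> u + \<Phi> v) / 2 - (2 - \<nu>) / 8 * d u v"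
    and H_mid: "H (mid u v) \<le> (H u + H v) / 2" if uv: "u \<in> V" "v \<in> V" for u v
  proof -
    note uv' = VH1[OF uv(1)] VH1[OF uv(2)]
    have N: "(H1_norm \<Omega> u)\<^sup>2 + (H1_norm \<Omega> v)\<^sup>2 - 2 * (H1_norm \<Omega> (mid u v))\<^sup>2 = 1 / 2 * d u v"
      unfolding d_def mid_def by (rule H1_norm_midpoint[OF \<Omega> uv'])
    have G: "\<bar>integral_functional \<Omega> g u + integral_functional \<Omega> g v
        - 2 * integral_functional \<Omega> g (mid u v)\<bar> \<le> \<nu> / 4 * d u v"
      unfolding d_def mid_def by (rule integral_functional_midpoint[OF \<Omega> g uv'])
    have F: "\<bar>J u + J v - 2 * J (mid u v)\<bar> \<le> L / 4 * d u v"
      unfolding d_def mid_def J_def by (rule integral_functional_midpoint[OF \<Omega> f uv'])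
    \<comment> \<open>\<open>e\<close> is the part of the convexity of the norm that \<open>I\<close> can destroy; \<open>J\<close> may use up the rest\<close>
    define e where "e = \<nu> / 4 * d u v"
    have e: "(2 - \<nu>) / 4 * d u v = 1 / 2 * d u v - e" "(2 - \<nu>) / 8 * d u v = 1 / 4 * d u v - e / 2"
      by (simp_all add: e_def field_simps)
    have P: "2 * \<Phi> (mid u v) \<le> \<Phi> u + \<Phi> v - (1 / 2 * d u v - e)"
      using N G unfolding \<Phi>_def e_def[symmetric] by (smt (verit))
    then show "\<Phi> (mid u v) \<le> (\<Phi> u + \<Phi> v) / 2 - (2 - \<nu>) / 8 * d u v"
      unfolding e by argo
    have "2 * J (mid u v) - (J u + J v) \<le> L / 4 * d u v"
      using F by linarith
    then have "c * (2 * J (mid u v) - (J u + J v)) \<le> c * (L / 4 * d u v)"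
      using c by (intro mult_left_mono) auto
    also have "\<dots> = 1 / 2 * d u v - e"
      using c(2) unfolding e(1)[symmetric] by simp
    finally have "2 * \<Phi> (mid u v) + c * (2 * J (mid u v) - (J u + J v)) \<le> \<Phi> u + \<Phi> v"
      using P by argo
    then have "2 * H (mid u v) \<le> H u + H v"
      unfolding H_def by (simp add: algebra_simps)
    then show "H (mid u v) \<le> (H u + H v) / 2"
      by argo
  qed
  have \<Phi>_tendsto: "(\<lambda>k. \<Phi> (s k)) \<longlonglongrightarrow> \<Phi> u"
    and J_tendsto: "(\<lambda>k. J (s k)) \<longlonglongrightarrow> J u"
    if "\<And>k::nat. s k \<in> V" "u \<in> V" "(\<lambda>k. d (s k) u) \<longlonglongrightarrow> 0" for s u
  proof -
    note prem = VH1[OF that(1)] VH1[OF that(2)] that(3)[unfolded d_def]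
    show "(\<lambda>k. \<Phi> (s k)) \<longlonglongrightarrow> \<Phi> u"
      unfolding \<Phi>_def
      by (intro tendsto_add H1_norm_power2_tendsto[OF \<Omega> prem] integral_functional_tendsto[OF \<Omega> g prem])
    show "(\<lambda>k. J (s k)) \<longlonglongrightarrow> J u"
      unfolding J_def by (rule integral_functional_tendsto[OF \<Omega> f prem])
  qed
  have H_tendsto: "(\<lambda>k. H (s k)) \<longlonglongrightarrow> H u"
    if "\<And>k::nat. s k \<in> V" "u \<in> V" "(\<lambda>k. d (s k) u) \<longlonglongrightarrow> 0" for s u
    unfolding H_def by (intro tendsto_intros \<Phi>_tendsto[OF that] J_tendsto[OF that])
  interpret convex_pair V d mid \<Phi> H "(2 - \<nu>) / 8"
  proof
    show "V \<noteq> {}"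
      using v0 by blast
    show "mid u v \<in> V" if "u \<in> V" "v \<in> V" for u v
      by (rule mid_in[OF that])
    show "0 \<le> d u v" "d u v = d v u" for u v
      unfolding d_def by (rule sqdist_nonneg sqdist_commute)+
    show "\<exists>u\<in>V. (\<lambda>k. d (s k) u) \<longlonglongrightarrow> 0"
      if "\<And>k::nat. s k \<in> V" "\<And>e. e > 0 \<Longrightarrow> \<exists>N. \<forall>m\<ge>N. \<forall>n\<ge>N. d (s m) (s n) < e" for s
      using that unfolding d_def by (rule closed_subspace_H1_complete[OF \<Omega> V])
    show "0 < (2 - \<nu>) / 8"
      using \<nu> by simp
    show "\<exists>B. \<forall>u\<in>V. B \<le> (1 - t) * \<Phi> u + t * H u" if t: "0 \<le> t" "t < 1" for t
    proof -
      have "t * (2 - \<nu>) < 1 * (2 - \<nu>)"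
        using t \<nu> by (intro mult_strict_right_mono) auto
      also have "\<dots> \<le> 2"
        using \<nu> by simp
      finally have "t * (2 - \<nu>) < 2" .
      then have "t * c * L < 2" "0 \<le> t * c"
        using c t by (simp_all add: mult.assoc)
      then obtain B where B: "\<And>u. u \<in> H1 \<Omega> \<Longrightarrow> B \<le> (H1_norm \<Omega> u)\<^sup>2 + t * c * J u"
        using penalized_functional_bounded_below[OF \<Omega> f, of "t * c"] unfolding J_def by blast
      have "B \<le> (1 - t) * \<Phi> u + t * H u" if "u \<in> V" for u
        using B[OF VH1[OF that]] g_nonneg[of u] by (simp add: \<Phi>_def H_def algebra_simps)
      then show ?thesis by blast
    qed
  qed (fact \<Phi>_tendsto H_tendsto \<Phi>_mid H_mid)+
  define z where "z = (\<lambda>x::'a. 0::real)"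
  have z: "z \<in> V"
    using V by (simp add: z_def closed_subspace_H1_def)
  have jz: "AE x in lebesgue_on \<Omega>. jet \<Omega> z x = 0"
    using jet_linear(2)[OF \<Omega> VH1[OF z] VH1[OF z], of 0 0] by (simp add: z_def)
  note sq = jet_square_integrable[OF VH1]
  have d_z: "d u z = (H1_norm \<Omega> u)\<^sup>2" if u: "u \<in> V" for u
    unfolding d_def sqdist_def H1_norm_power2
    using jz sqdist_integrable[OF sq[OF u] sq[OF z]] sq[OF u]
    by (intro integral_cong_AE) (auto simp: square_integrable_def borel_measurable_integrable)
  have Dg0: "Dg 0 = 0"
    by (rule gradient_eq_0_at_minimum[OF g(1)]) (simp add: assms)
  have norm_scale: "(H1_norm \<Omega> (\<lambda>x. t * v x))\<^sup>2 \<le> t\<^sup>2 * (H1_norm \<Omega> v)\<^sup>2" if "v \<in> V" for t v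
    using integral_functional_expansion[OF \<Omega> is_gradient_norm_power2 lipschitz_norm_power2_gradient VH1[OF that], where t = t]
    by (simp add: H1_norm_power2 integral_functional_jet)
  have g_scale: "integral_functional \<Omega> g (\<lambda>x. t * v x) \<le> \<nu> / 2 * t\<^sup>2 * (H1_norm \<Omega> v)\<^sup>2" if "v \<in> V" for t v
    using integral_functional_expansion[OF \<Omega> g VH1[OF that], where t = t] by (simp add: Dg0 assms)
  have \<Phi>_ge: "(H1_norm \<Omega> u)\<^sup>2 \<le> \<Phi> u" for u
    using g_nonneg by (simp add: \<Phi>_def)
  have \<Phi>_nonneg: "0 \<le> \<Phi> u" for u
    using \<Phi>_ge[of u] order_trans zero_le_power2 by blast
  have \<Phi>_z: "\<Phi> z = 0"
  proof -
    \<comment> \<open>the scaling bounds for \<open>t = 0\<close>\<close>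
    have "\<Phi> z \<le> 0"
      using norm_scale[OF z, of 0] g_scale[OF z, of 0] by (simp add: \<Phi>_def z_def)
    then show ?thesis using \<Phi>_nonneg[of z] by simp
  qed
  have z_S: "z \<notin> S"
  proof
    assume "z \<in> S"
    then have min: "H z \<le> H u" if "u \<in> V" for u
      using that by (simp add: S global_minima_def)
    define a where "a = (LINT x|lebesgue_on \<Omega>. Df 0 \<bullet> jet \<Omega> v0 x)"
    define N where "N = (H1_norm \<Omega> v0)\<^sup>2"
    have a: "a \<noteq> 0"
      using v0(2) by (simp add: a_def jet_def inner_prod_def)
    have "0 \<le> (c * a) * t + ((1 + \<nu> / 2 + c * L / 2) * N) * t\<^sup>2" for t
    proof -
      have tv: "(\<lambda>x. t * v0 x) \<in> V"
        using closed_subspace_H1_linear[OF V v0(1) v0(1), of t 0] by simp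
      define m where "m = f 0 * measure (lebesgue_on \<Omega>) \<Omega>"
      have "\<bar>J z - m\<bar> \<le> 0"
        using integral_functional_expansion[OF \<Omega> f VH1[OF z], where t = 0] by (simp add: J_def z_def m_def)
      moreover have "\<bar>J (\<lambda>x. t * v0 x) - m - t * a\<bar> \<le> L / 2 * t\<^sup>2 * N"
        using integral_functional_expansion[OF \<Omega> f VH1[OF v0(1)], where t = t] by (simp add: J_def m_def a_def N_def)
      ultimately have "J (\<lambda>x. t * v0 x) - J z \<le> t * a + L / 2 * t\<^sup>2 * N"
        by (smt (verit))
      then have "c * (J (\<lambda>x. t * v0 x) - J z) \<le> c * (t * a + L / 2 * t\<^sup>2 * N)"
        using c by (intro mult_left_mono) auto
      moreover have "\<Phi> (\<lambda>x. t * v0 x) \<le> t\<^sup>2 * N + \<nu> / 2 * t\<^sup>2 * N"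
        unfolding \<Phi>_def N_def by (intro add_mono norm_scale g_scale v0)
      moreover have "0 \<le> \<Phi> (\<lambda>x. t * v0 x) + c * (J (\<lambda>x. t * v0 x) - J z)"
        using min[OF tv] \<Phi>_z by (simp add: H_def algebra_simps)
      ultimately have "0 \<le> t\<^sup>2 * N + \<nu> / 2 * t\<^sup>2 * N + c * (t * a + L / 2 * t\<^sup>2 * N)"
        by (smt (verit))
      then show ?thesis
        by (simp add: algebra_simps)
    qed
    then have "c * a = 0"
      by (rule quadratic_nonneg_imp_linear_coeff_0) (use \<nu> c in \<open>simp add: N_def\<close>)
    then show False
      using a c by simp
  qed
  have "\<delta> > 0"
  proof (rule ccontr)
    assume "\<not> \<delta> > 0"
    then have "\<delta> < ereal (inverse (real (Suc k)))" for k
      by (intro order.strict_trans1[of \<delta> 0]) auto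
    then have "\<exists>u\<in>S. \<Phi> u < inverse (real (Suc k))" for k
      unfolding \<delta>_def INF_less_iff by simp
    then obtain s where s: "\<And>k. s k \<in> S" "\<And>k. \<Phi> (s k) < inverse (real (Suc k))"
      by metis
    have sV: "s k \<in> V" and s_min: "v \<in> V \<Longrightarrow> H (s k) \<le> H v" for k v
      using s(1)[of k] by (auto simp: S global_minima_def)
    have "(\<lambda>k. d (s k) z) \<longlonglongrightarrow> 0"
    proof (rule tendsto_sandwich[OF _ _ tendsto_const LIMSEQ_inverse_real_of_nat])
      show "\<forall>\<^sub>F k in sequentially. d (s k) z \<le> inverse (real (Suc k))"
        using \<Phi>_ge s(2) d_z[OF sV] by (intro always_eventually allI) (metis less_imp_le order_trans)
    qed (simp add: d_nonneg)
    then have "(\<lambda>k. H (s k)) \<longlonglongrightarrow> H z"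
      by (rule H_tendsto[OF sV z])
    then have "H z \<le> H v" if "v \<in> V" for v
      by (rule LIMSEQ_le_const2) (use s_min[OF that] in blast)
    then show False
      using z_S z by (simp add: S global_minima_def)
  qed
  moreover have "\<exists>u\<in>global_minima J {u \<in> V. \<Phi> u = r}.
        \<forall>w\<in>global_minima J {u \<in> V. \<Phi> u = r}. AE x in lebesgue_on \<Omega>. w x = u x"
    if r: "0 < r" "ereal r < \<delta>" for r
  proof -
    have z_min: "z \<in> global_minima \<Phi> V"
      using z \<Phi>_z \<Phi>_nonneg by (simp add: global_minima_def)
    have "r < \<Phi> u" if "u \<in> global_minima H V" for u
    proof -
      have "\<delta> \<le> ereal (\<Phi> u)"
        unfolding \<delta>_def S by (rule INF_lower[OF that])
      with r(2) have "ereal r < ereal (\<Phi> u)"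
        by (rule order.strict_trans2)
      then show ?thesis by simp
    qed
    then obtain t u where t: "0 \<le> t" "t < 1" and u: "u \<in> global_minima (blend t) V" "\<Phi> u = r"
      using minimizer_on_level[OF z_min, of r] \<Phi>_z r by (metis less_imp_le)
    have uV: "u \<in> V" and u_min: "v \<in> V \<Longrightarrow> blend t u \<le> blend t v" for v
      using u(1) by (auto simp: global_minima_def)
    have F: "blend t v = \<Phi> v + t * c * J v" for v
      unfolding blend_def by (simp add: H_def algebra_simps)
    \<comment> \<open>otherwise \<open>u\<close> would minimize \<open>\<Phi>\<close>, with value \<open>r > 0 = \<Phi> z\<close>\<close>
    have "t \<noteq> 0"
      using u_min[OF z] \<Phi>_z u(2) r(1) by (auto simp: F)
    then have tc: "t * c > 0"
      using t c by simp
    have "J u \<le> J v" if "v \<in> V" "\<Phi> v = r" for v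
      using u_min[OF that(1)] that(2) u(2) mult_le_cancel_left_pos[OF tc] by (simp add: F)
    then have "u \<in> global_minima J {u \<in> V. \<Phi> u = r}"
      using uV u(2) by (simp add: global_minima_def)
    moreover have "AE x in lebesgue_on \<Omega>. w x = u x" if w: "w \<in> global_minima J {u \<in> V. \<Phi> u = r}" for w
    proof -
      have wV: "w \<in> V" "\<Phi> w = r" "J w \<le> J u"
        using w uV u(2) by (auto simp: global_minima_def)
      then have "blend t w \<le> blend t u"
        using u(2) mult_le_cancel_left_pos[OF tc] by (simp add: F)
      then have "w \<in> global_minima (blend t) V"
        using wV(1) order_trans[OF _ u_min] by (simp add: global_minima_def)
      then have "d w u = 0"
        by (rule minimizer_unique[OF t _ u(1)])
      then have "AE x in lebesgue_on \<Omega>. jet \<Omega> w x = jet \<Omega> u x"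
        unfolding d_def by (rule sqdist_eq_0_imp_AE_eq[OF sq[OF wV(1)] sq[OF uV]])
      then show ?thesis
        by eventually_elim (simp add: jet_def)
    qed
    ultimately show ?thesis by blast
  qed
  ultimately show ?thesis by blast
qed

end
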